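(* Let $G=(V,E)$ be a chain graph and let $\tau$ be a chain component of $G$. If $\tau$ is complete and all counts $n(i_\tau,i_{\mathrm{pa}_D(\tau)})$, $i_\tau\in\mathcal{I}_\tau$, $i_{\mathrm{pa}_D(\tau)}\in\mathcal{I}_{\mathrm{pa}_D(\tau)}$, are positive, then the component log-likelihood function $$\ell_\tau(p)=\sum_{i_\tau\in\mathcal{I}_\tau}\ \sum_{i_{\mathrm{pa}_D(\tau)}\in\mathcal{I}_{\mathrm{pa}_D(\tau)}}n(i_\tau,i_{\mathrm{pa}_D(\tau)})\log p(i_\tau\mid i_{\mathrm{pa}_D(\tau)})$$ in the model $\mathbf{P}_{\mathrm{IV}}(G)$, regarded as a function of the array of conditional probabilities $\bigl(p(i_\tau\mid i_{\mathrm{pa}_D(\tau)})\bigr)_{i_\tau,\,i_{\mathrm{pa}_D(\tau)}}$ ranging over all arrays that arise from some $p\in\mathbf{P}_{\mathrm{IV}}(G)$, has a unique local and thus global maximum.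
   Context: Graphs. $G=(V,E)$ has finite vertex set $V$ and $E\subseteq(V\times V)\setminus\{(v,v):v\in V\}$. An edge $(v,w)\in E$ is undirected ($v-w$) if $(w,v)\in E$, and directed ($v\to w$) otherwise. If $v\to w$, $v$ is a parent of $w$; if $v-w$, $v$ is a neighbor of $w$; $\mathrm{pa}_G(v)$ and $\mathrm{nb}_G(v)$ are the sets of parents and neighbors of $v$. For $\sigma\subseteq V$, $\mathrm{pa}_G(\sigma)=(\bigcup_{v\in\sigma}\mathrm{pa}_G(v))\setminus\sigma$, $\mathrm{nb}_G(\sigma)=(\bigcup_{v\in\sigma}\mathrm{nb}_G(v))\setminus\sigma$, $\mathrm{Nb}_G(\sigma)=\mathrm{nb}_G(\sigma)\cup\sigma$. A semi-directed cycle is a sequence of distinct vertices $v_0,\dots,v_k$ with $(v_i,v_{i+1})\in E$ for $0\le i\le k$ (where $v_{k+1}=v_0$), at least one of these edges being directed. A chain graph is a graph without semi-directed cycles. Its chain components are the equivalence classes of vertices under the relation "joined by a path of undirected edges"; $\mathscr{T}$ is the set of chain components. A set of vertices is complete if every pair of its vertices is joined by an edge. $D=D(G)$ is the acyclic digraph with vertex set $\mathscr{T}$ and an edge $\tau_1\to\tau_2$ iff $v\to w$ in $G$ for some $v\in\tau_1,w\in\tau_2$. For $\tau\in\mathscr{T}$, $\mathrm{pa}_D(\tau)\subseteq V$ is the union of all parents of $\tau$ in $D$, and $\mathrm{nd}_D(\tau)\subseteq V$ is the union of all $\bar\tau\in\mathscr{T}\setminus\{\tau\}$ such that there is no directed path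 from $\tau$ to $\bar\tau$ in $D$. Model. $X=(X_v\mid v\in V)$ is a random vector with $X_v$ taking values in $[d_v]=\{1,\dots,d_v\}$; $\mathcal{I}=\prod_{v\in V}[d_v]$ and $\mathcal{I}_\alpha=\prod_{v\in\alpha}[d_v]$ for $\alpha\subseteq V$. Joint distributions are identified with vectors $p=(p(i)\mid i\in\mathcal{I})$, $p(i)=P(X=i)$, in the probability simplex $\Delta$; $\Delta^o$ is its interior (all $p(i)>0$). Write $p(i_\tau\mid i_{\mathrm{pa}_D(\tau)})=P(X_\tau=i_\tau\mid X_{\mathrm{pa}_D(\tau)}=i_{\mathrm{pa}_D(\tau)})$. For disjoint $\alpha,\beta,\gamma\subseteq V$, $\alpha\perp\!\!\!\perp\beta\mid\gamma$ means that $X_\alpha$ and $X_\beta$ are conditionally independent given $X_\gamma$ (marginally independent if $\gamma=\varnothing$; void if $\alpha$ or $\beta$ is empty). The model $\mathbf{P}_{\mathrm{IV}}(G)$ is the set of $p\in\Delta^o$ obeying the block-recursive Markov property of type IV: for all $\tau\in\mathscr{T}$ and all $\sigma\subseteq\tau$, (C1) $\tau\perp\!\!\!\perp[\mathrm{nd}_D(\tau)\setminus\mathrm{pa}_D(\tau)]\mid\mathrm{pa}_D(\tau)$; (C2b) $\sigma\perp\!\!\!\perp[\tau\setminus\mathrm{Nb}_G(\sigma)]\mid\mathrm{pa}_D(\tau)$; (C3b) $\sigma\perp\!\!\!\perp[\mathrm{pa}_D(\tau)\setminus\mathrm{pa}_G(\sigma)]\mid\mathrm{pa}_G(\sigma)$.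 Data. Given a sample $X^{(1)},\dots,X^{(n)}$ of vectors in $\mathcal{I}$, let $n(i)=\#\{k: X^{(k)}=i\}$ for $i\in\mathcal{I}$, and for $\alpha\subseteq V$, $i_\alpha\in\mathcal{I}_\alpha$, let $n(i_\alpha)=\sum_{j\in\mathcal{I}:\,j_\alpha=i_\alpha}n(j)$; $n(i_\tau,i_{\mathrm{pa}_D(\tau)})$ is this count for $\alpha=\tau\cup\mathrm{pa}_D(\tau)$. *)

theory Defs
  imports "HOL-Probability.Probability"
begin

definition graph_on :: "'v set \<Rightarrow> ('v \<times> 'v) set \<Rightarrow> bool" where
  "graph_on V E \<longleftrightarrow> finite V \<and> E \<subseteq> V \<times> V - {(v, v) | v. v \<in> V}"

definition undirected_edges :: "('v \<times> 'v) set \<Rightarrow> ('v \<times> 'v) set" where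
  "undirected_edges E = {(v, w). (v, w) \<in> E \<and> (w, v) \<in> E}"

definition directed_edges :: "('v \<times> 'v) set \<Rightarrow> ('v \<times> 'v) set" where
  "directed_edges E = {(v, w). (v, w) \<in> E \<and> (w, v) \<notin> E}"

definition pa :: "('v \<times> 'v) set \<Rightarrow> 'v set \<Rightarrow> 'v set" where
  "pa E \<sigma> = (\<Union>w\<in>\<sigma>. {v. (v, w) \<in> directed_edges E}) - \<sigma>"

definition nb :: "('v \<times> 'v) set \<Rightarrow> 'v set \<Rightarrow> 'v set" where
  "nb E \<sigma> = (\<Union>w\<in>\<sigma>. {v. (v, w) \<in> undirected_edges E}) - \<sigma>"

definition Nb :: "('v \<times> 'v) set \<Rightarrow> 'v set \<Rightarrow> 'v set" where
  "Nb E \<sigma> = nb E \<sigma> \<union> \<sigma>"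

definition semidirected_cycle :: "('v \<times> 'v) set \<Rightarrow> 'v list \<Rightarrow> bool" where
  "semidirected_cycle E vs \<longleftrightarrow> vs \<noteq> [] \<and> distinct vs \<and>
     (\<forall>i < length vs. (vs ! i, vs ! (Suc i mod length vs)) \<in> E) \<and>
     (\<exists>i < length vs. (vs ! i, vs ! (Suc i mod length vs)) \<in> directed_edges E)"

definition chain_graph :: "'v set \<Rightarrow> ('v \<times> 'v) set \<Rightarrow> bool" where
  "chain_graph V E \<longleftrightarrow> graph_on V E \<and> (\<nexists>vs. semidirected_cycle E vs)"

definition chain_components :: "'v set \<Rightarrow> ('v \<times> 'v) set \<Rightarrow> 'v set set" where
  "chain_components V E = V // {(v, w) \<in> V \<times> V. (v, w) \<in> (undirected_edges E)\<^sup>*}"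

definition complete_set :: "('v \<times> 'v) set \<Rightarrow> 'v set \<Rightarrow> bool" where
  "complete_set E \<sigma> \<longleftrightarrow> (\<forall>v\<in>\<sigma>. \<forall>w\<in>\<sigma>. v \<noteq> w \<longrightarrow> (v, w) \<in> E \<or> (w, v) \<in> E)"

text \<open>The edge set of the digraph \<open>D\<close> of chain components. The functions \<open>pa_D\<close> and \<open>nd_D\<close>
  return sets of vertices of the original graph, not sets of components.\<close>

definition component_dag :: "'v set \<Rightarrow> ('v \<times> 'v) set \<Rightarrow> ('v set \<times> 'v set) set" where
  "component_dag V E =
     {(\<tau>1, \<tau>2) \<in> chain_components V E \<times> chain_components V E.
        \<exists>v\<in>\<tau>1. \<exists>w\<in>\<tau>2. (v, w) \<in> directed_edges E}"

definition pa_D :: "'v set \<Rightarrow> ('v \<times> 'v) set \<Rightarrow> 'v set \<Rightarrow> 'v set" where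
  "pa_D V E \<tau> = \<Union> {\<rho>. (\<rho>, \<tau>) \<in> component_dag V E}"

definition nd_D :: "'v set \<Rightarrow> ('v \<times> 'v) set \<Rightarrow> 'v set \<Rightarrow> 'v set" where
  "nd_D V E \<tau> = \<Union> {\<rho> \<in> chain_components V E - {\<tau>}. (\<tau>, \<rho>) \<notin> (component_dag V E)\<^sup>+}"


text \<open>\<open>configs d \<alpha>\<close> is the set of states of the subvector indexed by \<open>\<alpha>\<close>. A state is a function
  that is \<open>undefined\<close> outside \<open>\<alpha>\<close>, so \<open>restrict\<close> passes from a state to its substates.\<close>

definition configs :: "('v \<Rightarrow> nat) \<Rightarrow> 'v set \<Rightarrow> ('v \<Rightarrow> nat) set" where
  "configs d \<alpha> = (\<Pi>\<^sub>E v\<in>\<alpha>. {1..d v})"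

definition open_simplex :: "'v set \<Rightarrow> ('v \<Rightarrow> nat) \<Rightarrow> ('v \<Rightarrow> nat) pmf set" where
  "open_simplex V d = {p. set_pmf p = configs d V}"

text \<open>Conditional independence of the subvectors indexed by \<open>\<alpha>\<close> and \<open>\<beta>\<close> given the one indexed by
  \<open>\<gamma>\<close>. It is only meant for disjoint index sets, so a single \<open>i\<close> ranges over all combinations of
  their states. If the conditioning event has probability zero, all three conditional
  probabilities are zero by convention and the equation holds.\<close>

definition cond_indep :: "('v \<Rightarrow> nat) pmf \<Rightarrow> 'v set \<Rightarrow> 'v set \<Rightarrow> 'v set \<Rightarrow> bool" where
  "cond_indep p \<alpha> \<beta> \<gamma> \<longleftrightarrow> (\<forall>i.
     \<P>(x in measure_pmf p. restrict x \<alpha> = restrict i \<alpha> \<and> restrict x \<beta> = restrict i \<beta>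
                            \<bar> restrict x \<gamma> = restrict i \<gamma>) =
     \<P>(x in measure_pmf p. restrict x \<alpha> = restrict i \<alpha> \<bar> restrict x \<gamma> = restrict i \<gamma>) *
     \<P>(x in measure_pmf p. restrict x \<beta> = restrict i \<beta> \<bar> restrict x \<gamma> = restrict i \<gamma>))"

definition P_IV :: "'v set \<Rightarrow> ('v \<times> 'v) set \<Rightarrow> ('v \<Rightarrow> nat) \<Rightarrow> ('v \<Rightarrow> nat) pmf set" where
  "P_IV V E d = {p \<in> open_simplex V d. \<forall>\<tau> \<in> chain_components V E. \<forall>\<sigma> \<subseteq> \<tau>.
     cond_indep p \<tau> (nd_D V E \<tau> - pa_D V E \<tau>) (pa_D V E \<tau>) \<and>
     cond_indep p \<sigma> (\<tau> - Nb E \<sigma>) (pa_D V E \<tau>) \<and>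
     cond_indep p \<sigma> (pa_D V E \<tau> - pa E \<sigma>) (pa E \<sigma>)}"

text \<open>The array of conditional probabilities of component \<open>\<tau>\<close>, indexed by pairs of a state of
  \<open>\<tau>\<close> and a state of its parents. Since it is \<open>undefined\<close> at all other arguments, the product
  topology of the function type induces on these arrays the usual topology of a
  finite-dimensional real vector space.\<close>

definition cond_array ::
  "'v set \<Rightarrow> ('v \<times> 'v) set \<Rightarrow> ('v \<Rightarrow> nat) \<Rightarrow> 'v set \<Rightarrow> ('v \<Rightarrow> nat) pmf \<Rightarrow>
     ('v \<Rightarrow> nat) \<times> ('v \<Rightarrow> nat) \<Rightarrow> real" where
  "cond_array V E d \<tau> p =
     (\<lambda>(a, b) \<in> configs d \<tau> \<times> configs d (pa_D V E \<tau>).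
        \<P>(x in measure_pmf p. restrict x \<tau> = a \<bar> restrict x (pa_D V E \<tau>) = b))"

definition cond_arrays ::
  "'v set \<Rightarrow> ('v \<times> 'v) set \<Rightarrow> ('v \<Rightarrow> nat) \<Rightarrow> 'v set \<Rightarrow>
     (('v \<Rightarrow> nat) \<times> ('v \<Rightarrow> nat) \<Rightarrow> real) set" where
  "cond_arrays V E d \<tau> = cond_array V E d \<tau> ` P_IV V E d"


definition cell_count :: "nat \<Rightarrow> (nat \<Rightarrow> 'v \<Rightarrow> nat) \<Rightarrow> ('v \<Rightarrow> nat) \<Rightarrow> nat" where
  "cell_count n X i = card {k \<in> {1..n}. X k = i}"

definition marginal_count ::
  "'v set \<Rightarrow> ('v \<Rightarrow> nat) \<Rightarrow> nat \<Rightarrow> (nat \<Rightarrow> 'v \<Rightarrow> nat) \<Rightarrow> 'v set \<Rightarrow> ('v \<Rightarrow> nat) \<Rightarrow> nat" where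
  "marginal_count V d n X \<alpha> a = (\<Sum>j \<in> {j \<in> configs d V. restrict j \<alpha> = a}. cell_count n X j)"

definition component_count ::
  "'v set \<Rightarrow> ('v \<times> 'v) set \<Rightarrow> ('v \<Rightarrow> nat) \<Rightarrow> nat \<Rightarrow> (nat \<Rightarrow> 'v \<Rightarrow> nat) \<Rightarrow> 'v set \<Rightarrow>
     ('v \<Rightarrow> nat) \<Rightarrow> ('v \<Rightarrow> nat) \<Rightarrow> nat" where
  "component_count V E d n X \<tau> a b =
     marginal_count V d n X (\<tau> \<union> pa_D V E \<tau>) (merge \<tau> (pa_D V E \<tau>) (a, b))"

definition component_loglik ::
  "'v set \<Rightarrow> ('v \<times> 'v) set \<Rightarrow> ('v \<Rightarrow> nat) \<Rightarrow> nat \<Rightarrow> (nat \<Rightarrow> 'v \<Rightarrow> nat) \<Rightarrow> 'v set \<Rightarrow>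
     (('v \<Rightarrow> nat) \<times> ('v \<Rightarrow> nat) \<Rightarrow> real) \<Rightarrow> real" where
  "component_loglik V E d n X \<tau> \<theta> =
     (\<Sum>a \<in> configs d \<tau>. \<Sum>b \<in> configs d (pa_D V E \<tau>).
        real (component_count V E d n X \<tau> a b) * ln (\<theta> (a, b)))"

definition local_max_on :: "('a::topological_space \<Rightarrow> real) \<Rightarrow> 'a set \<Rightarrow> 'a \<Rightarrow> bool" where
  "local_max_on f S x \<longleftrightarrow> x \<in> S \<and> (\<forall>\<^sub>F y in at x within S. f y \<le> f x)"

end

theory Submission
  imports Defs "HOL-Library.Transitive_Closure_Table"
begin

text \<open>If \<open>\<tau>\<close> is complete, condition (C2b) for \<open>\<tau>\<close> is void, and (C3b) says that the marginal array of
  every \<open>\<sigma> \<subseteq> \<tau>\<close> depends on the parent state only through \<open>pa \<sigma>\<close>, which is linear in the array of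
  conditional probabilities. Conversely, every positive array that satisfies these linear equations
  and the normalization arises from the model: take all variables outside \<open>\<tau>\<close> independent and uniform
  and \<open>X\<^sub>\<tau>\<close> distributed according to the array given its parents. The conditions for the other components then
  hold because a component that contains a parent of \<open>\<tau>\<close> has no vertex of \<open>\<tau>\<close> among its non-descendants.
  So the arrays form a convex set, relatively closed in the positive arrays, on which the
  log-likelihood is strictly concave and tends to \<open>-\<infinity>\<close> at the boundary.\<close>

section \<open>Weighted sums of logarithms on convex sets\<close>

text \<open>The tangent bound \<open>ln u \<le> u - 1\<close>, strict unless \<open>u = 1\<close>,
  is applied at \<open>x / m\<close> and \<open>y / m\<close>, where \<open>m\<close> is the convex
  combination; the weighted right-hand sides add up to zero.\<close>

lemma ln_convex_combination_less:
  fixes x y t :: real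
  assumes "0 < x" "0 < y" "x \<noteq> y" "0 < t" "t < 1"
  shows "(1 - t) * ln x + t * ln y < ln ((1 - t) * x + t * y)"
proof -
  define m where "m = (1 - t) * x + t * y"
  have m: "m > 0"
    unfolding m_def using assms by (intro add_pos_pos mult_pos_pos) auto
  have "x \<noteq> m"
    using assms by (auto simp: m_def algebra_simps)
  then have "ln (x / m) < x / m - 1"
    using m \<open>0 < x\<close> ln_le_minus_one[of "x / m"] ln_eq_minus_one[of "x / m"] by fastforce
  then have "(1 - t) * ln (x / m) < (1 - t) * (x / m - 1)"
    using \<open>t < 1\<close> by simp
  moreover have "t * ln (y / m) \<le> t * (y / m - 1)"
    using m assms by (intro mult_left_mono ln_le_minus_one) auto
  moreover have "(1 - t) * (x / m - 1) + t * (y / m - 1) = 0"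
    using m by (simp add: m_def field_simps)
  ultimately have "(1 - t) * ln (x / m) + t * ln (y / m) < 0"
    by linarith
  then have "(1 - t) * (ln x - ln m) + t * (ln y - ln m) < 0"
    using m assms by (simp add: ln_div)
  then show ?thesis
    by (simp add: m_def algebra_simps)
qed

text \<open>\<open>C\<close> carries the closed constraints and \<open>S\<close> adds positivity.
  Entries at most 1 make every summand nonpositive, which confines all arrays at least as good as a
  given one to a compact subset of \<open>S\<close>, so a maximum exists. Strict concavity along
  segments then excludes any other local maximum.\<close>

lemma weighted_log_sum_unique_local_max:
  fixes S C :: "('a \<Rightarrow> real) set" and c :: "'a \<Rightarrow> real" and D :: "'a set"
  defines "f \<equiv> (\<lambda>\<theta>. \<Sum>x\<in>D. c x * ln (\<theta> x))"
  assumes "finite D" and c: "\<And>x. x \<in> D \<Longrightarrow> c x > 0"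
    and "closed C" and S: "S = {\<theta>\<in>C. \<forall>x\<in>D. \<theta> x > 0}" and "S \<noteq> {}"
    and ext: "C \<subseteq> extensional D" and le1: "\<And>\<theta> x. \<theta> \<in> S \<Longrightarrow> x \<in> D \<Longrightarrow> \<theta> x \<le> 1"
    and conv: "\<And>\<theta> \<theta>' t. \<theta> \<in> C \<Longrightarrow> \<theta>' \<in> C \<Longrightarrow> 0 < t \<Longrightarrow> t < 1 \<Longrightarrow> (\<lambda>x. (1 - t) * \<theta> x + t * \<theta>' x) \<in> C"
  shows "(\<exists>!\<theta>. local_max_on f S \<theta>) \<and> (\<forall>\<theta>. local_max_on f S \<theta> \<longrightarrow> is_arg_max f (\<lambda>\<theta>'. \<theta>' \<in> S) \<theta>)"
proof -
  obtain \<theta>0 where \<theta>0: "\<theta>0 \<in> S"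
    using \<open>S \<noteq> {}\<close> by blast
  have term_le: "f \<theta> \<le> c x * ln (\<theta> x)" if "\<theta> \<in> S" "x \<in> D" for \<theta> x
  proof -
    have "(\<Sum>y\<in>D-{x}. c y * ln (\<theta> y)) \<le> 0"
      using that le1[OF that(1)] c S by (intro sum_nonpos mult_nonneg_nonpos) (auto simp: less_imp_le)
    then show ?thesis
      unfolding f_def using sum.remove[OF \<open>finite D\<close> that(2), of "\<lambda>y. c y * ln (\<theta> y)"] by simp
  qed
  \<comment> \<open>A single summand is bounded below by the whole sum, so arrays at least as good as \<open>\<theta>0\<close> stay
    away from the boundary.\<close>
  define low where "low = (\<lambda>x. exp (f \<theta>0 / c x))"
  define K where "K = C \<inter> (\<Pi>\<^sub>E x\<in>D. {low x..1})"
  \<comment> \<open>Coordinates outside \<open>D\<close> get the one-point factor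
    \<open>{undefined}\<close>, so that the box becomes a product over the whole index type and
    Tychonoff's theorem applies.\<close>
  have PiE_eq: "(\<Pi>\<^sub>E x\<in>D. {low x..1}) = (\<Pi>\<^sub>E x\<in>UNIV. if x \<in> D then {low x..1} else {undefined})"
    by (auto simp: PiE_def Pi_def extensional_def split: if_splits)
  have "compactin (product_topology (\<lambda>_. euclidean) UNIV) (\<Pi>\<^sub>E x\<in>UNIV. if x \<in> D then {low x..1} else {undefined})"
    unfolding compactin_PiE by auto
  then have "compact (\<Pi>\<^sub>E x\<in>D. {low x..1})"
    unfolding PiE_eq by (simp add: euclidean_product_topology)
  then have "compact K"
    unfolding K_def using \<open>closed C\<close> by (rule closed_Int_compact[rotated])
  have K_iff: "\<theta> \<in> K" if "\<theta> \<in> S" "f \<theta> \<ge> f \<theta>0" for \<theta>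
  proof -
    have "low x \<le> \<theta> x" if "x \<in> D" for x
    proof -
      have "f \<theta>0 / c x \<le> ln (\<theta> x)"
        using term_le[OF \<open>\<theta> \<in> S\<close> that] \<open>f \<theta> \<ge> f \<theta>0\<close> c[OF that] by (simp add: field_simps)
      then show ?thesis
        using S \<open>\<theta> \<in> S\<close> that by (simp add: low_def ln_ge_iff)
    qed
    then show ?thesis
      using that S ext le1 by (auto simp: K_def PiE_iff)
  qed
  have K_sub: "K \<subseteq> S"
  proof
    fix \<theta> assume "\<theta> \<in> K"
    then have "\<theta> \<in> C" "\<And>x. x \<in> D \<Longrightarrow> low x \<le> \<theta> x"
      by (auto simp: K_def)
    moreover have "low x > 0" for x
      by (simp add: low_def)
    ultimately show "\<theta> \<in> S"
      unfolding S by (auto intro: less_le_trans)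
  qed
  have "continuous_on K f"
    unfolding f_def
  proof (intro continuous_intros)
    fix x assume "x \<in> D"
    then show "\<forall>\<theta>\<in>K. \<theta> x \<noteq> 0"
      using K_sub S by force
  qed (auto intro: continuous_on_subset[OF continuous_on_product_coordinates])
  then obtain \<theta>1 where \<theta>1: "\<theta>1 \<in> K" "\<And>\<theta>. \<theta> \<in> K \<Longrightarrow> f \<theta> \<le> f \<theta>1"
    using continuous_attains_sup[OF \<open>compact K\<close>] K_iff[OF \<theta>0] by blast
  have max: "f \<theta> \<le> f \<theta>1" if "\<theta> \<in> S" for \<theta>
    using that K_iff[OF that] \<theta>1(2) K_iff[OF \<theta>0] by fastforce
  \<comment> \<open>The comparison is between a local maximum and any point that is no worse. Taking
    the global maximum \<open>\<theta>1\<close> as \<open>\<theta>'\<close> identifies every local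
    maximum with it.\<close>
  have uniq: "\<theta> = \<theta>'" if loc: "local_max_on f S \<theta>" and \<theta>': "\<theta>' \<in> S" "f \<theta> \<le> f \<theta>'" for \<theta> \<theta>'
  proof (rule ccontr)
    assume neq: "\<theta> \<noteq> \<theta>'"
    have \<theta>: "\<theta> \<in> S"
      using loc by (simp add: local_max_on_def)
    have "\<theta> \<in> extensional D" "\<theta>' \<in> extensional D"
      using \<theta> \<theta>'(1) S ext by auto
    then obtain x0 where x0: "x0 \<in> D" "\<theta> x0 \<noteq> \<theta>' x0"
      using neq extensionalityI[of \<theta> D \<theta>'] by blast
    \<comment> \<open>The segment from \<open>\<theta>\<close> to \<open>\<theta>'\<close> is
      strictly better than \<open>\<theta>\<close> at each interior parameter, yet it converges to
      \<open>\<theta>\<close> as \<open>t\<close> tends to 0.\<close>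
    define g where "g = (\<lambda>t x. (1 - t) * \<theta> x + t * \<theta>' x)"
    have gS: "g t \<in> S" if "0 < t" "t < 1" for t
      using that \<theta> \<theta>'(1) conv[of \<theta> \<theta>' t] unfolding S g_def by (auto intro!: add_pos_pos)
    have g_gt: "f (g t) > f \<theta>" if t: "0 < t" "t < 1" for t
    proof -
      have "f \<theta> \<le> (1 - t) * f \<theta> + t * f \<theta>'"
        using mult_left_mono[OF \<theta>'(2), of t] t by (simp add: algebra_simps)
      also have "\<dots> = (\<Sum>x\<in>D. c x * ((1 - t) * ln (\<theta> x) + t * ln (\<theta>' x)))"
        unfolding f_def sum_distrib_left sum.distrib[symmetric] by (intro sum.cong) (auto simp: algebra_simps)
      also have "\<dots> < f (g t)"
        unfolding f_def
      proof (rule sum_strict_mono_ex1[OF \<open>finite D\<close>])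
        have *: "(1 - t) * ln (\<theta> x) + t * ln (\<theta>' x) < ln (g t x)" if "x \<in> D" "\<theta> x \<noteq> \<theta>' x" for x
          using that \<theta> \<theta>'(1) t unfolding S g_def by (intro ln_convex_combination_less) auto
        moreover have "(1 - t) * ln (\<theta> x) + t * ln (\<theta>' x) = ln (g t x)" if "\<theta> x = \<theta>' x" for x
          using that by (simp add: g_def algebra_simps)
        ultimately have "(1 - t) * ln (\<theta> x) + t * ln (\<theta>' x) \<le> ln (g t x)" if "x \<in> D" for x
          using that by (metis less_imp_le order_refl)
        then show "\<forall>x\<in>D. c x * ((1 - t) * ln (\<theta> x) + t * ln (\<theta>' x)) \<le> c x * ln (g t x)"
          using c by (auto intro!: mult_left_mono less_imp_le)
        show "\<exists>x\<in>D. c x * ((1 - t) * ln (\<theta> x) + t * ln (\<theta>' x)) < c x * ln (g t x)"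
          using *[OF x0] c[OF x0(1)] x0(1) by (intro bexI[of _ x0] mult_strict_left_mono)
      qed
      finally show ?thesis .
    qed
    have "((\<lambda>t. g t) \<longlongrightarrow> g 0) (at_right 0)"
    proof -
      have "continuous_on UNIV g"
        unfolding g_def by (intro continuous_on_coordinatewise_then_product continuous_intros)
      then show ?thesis
        by (meson UNIV_I continuous_on_def filterlim_at_split tendsto_mono at_le subset_UNIV)
    qed
    moreover have "g 0 = \<theta>"
      by (simp add: g_def)
    moreover have ev: "\<forall>\<^sub>F t in at_right (0::real). 0 < t \<and> t < 1"
      using eventually_at_right_real[of 0 1] by (auto elim: eventually_mono)
    \<comment> \<open>The filter \<open>at \<theta> within S\<close> is punctured, so the segment
      must also avoid \<open>\<theta>\<close> itself; the strict increase of \<open>f\<close>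
      ensures this.\<close>
    then have "\<forall>\<^sub>F t in at_right 0. g t \<in> S \<and> g t \<noteq> \<theta>"
      by (rule eventually_mono) (use gS g_gt in fastforce)
    ultimately have "filterlim g (at \<theta> within S) (at_right 0)"
      by (simp add: filterlim_at)
    then have "\<forall>\<^sub>F t in at_right 0. f (g t) \<le> f \<theta>"
      using loc unfolding local_max_on_def filterlim_iff by blast
    with ev have "\<forall>\<^sub>F t in at_right (0::real). False"
      by eventually_elim (use g_gt in fastforce)
    then show False
      by simp
  qed
  have "\<theta>1 \<in> S"
    using \<theta>1(1) K_sub by blast
  have eq: "\<theta> = \<theta>1" if "local_max_on f S \<theta>" for \<theta>
    using that by (intro uniq \<open>\<theta>1 \<in> S\<close> max) (auto simp: local_max_on_def)
  have "local_max_on f S \<theta>1"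
    using \<open>\<theta>1 \<in> S\<close> max by (auto simp: local_max_on_def eventually_at_filter)
  moreover have "is_arg_max f (\<lambda>\<theta>'. \<theta>' \<in> S) \<theta>1"
    using \<open>\<theta>1 \<in> S\<close> max by (simp add: is_arg_max_linorder)
  ultimately show ?thesis
    using eq by (intro conjI ex1I[of _ \<theta>1]) blast+
qed

section \<open>Chain components\<close>

text \<open>A path from \<open>w\<close> back to \<open>v\<close> can be chosen with distinct
  vertices, and the directed edge would close it to a semi-directed cycle.\<close>

lemma chain_graph_no_path_back:
  assumes "chain_graph V E" "(v, w) \<in> directed_edges E"
  shows "(w, v) \<notin> E\<^sup>*"
proof
  assume "(w, v) \<in> E\<^sup>*"
  then have "(\<lambda>x y. (x, y) \<in> E)\<^sup>*\<^sup>* w v"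
    by (simp add: rtranclp_rtrancl_eq)
  then obtain xs0 where "rtrancl_path (\<lambda>x y. (x, y) \<in> E) w xs0 v"
    by (auto simp: rtranclp_eq_rtrancl_path)
  then obtain xs where xs: "rtrancl_path (\<lambda>x y. (x, y) \<in> E) w xs v" "distinct (w # xs)"
    by (rule rtrancl_path_distinct)
  have "xs \<noteq> []"
    using assms(2) xs(1) by (auto simp: directed_edges_def elim: rtrancl_path.cases)
  \<comment> \<open>The list \<open>xs\<close> omits the start \<open>w\<close> and ends in
    \<open>v\<close>. Hence \<open>v\<close> has index \<open>length xs\<close> in
    \<open>vs\<close>, and the wrap-around edge leaving it is the given directed edge.\<close>
  define vs where "vs = w # xs"
  have last: "vs ! length xs = v" "vs ! 0 = w"
    using rtrancl_path_last[OF xs(1)] \<open>xs \<noteq> []\<close> by (auto simp: vs_def last_conv_nth nth_Cons')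
  have "(vs ! i, vs ! (Suc i mod length vs)) \<in> E" if "i < length vs" for i
  proof (cases "i < length xs")
    case True
    then show ?thesis
      using rtrancl_path_nth[OF xs(1)] by (simp add: vs_def)
  next
    case False
    then have "i = length xs"
      using that by (simp add: vs_def)
    then show ?thesis
      using assms(2) last by (simp add: directed_edges_def) (simp add: vs_def)
  qed
  moreover have "(vs ! length xs, vs ! (Suc (length xs) mod length vs)) \<in> directed_edges E"
    using assms(2) last by (simp add: vs_def)
  ultimately have "semidirected_cycle E vs"
    using xs(2) unfolding semidirected_cycle_def by (auto simp: vs_def)
  then show False
    using assms(1) by (auto simp: chain_graph_def)
qed

lemma equiv_undirected_connected:
  "equiv V {(v, w) \<in> V \<times> V. (v, w) \<in> (undirected_edges E)\<^sup>*}"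
proof -
  have "sym ((undirected_edges E)\<^sup>*)"
    by (intro sym_rtrancl) (auto simp: sym_def undirected_edges_def)
  then show ?thesis
    by (auto simp: equiv_def refl_on_def sym_def trans_def)
qed

lemma chain_component_subset:
  assumes "\<tau> \<in> chain_components V E"
  shows "\<tau> \<subseteq> V"
  using Union_upper[OF assms] unfolding chain_components_def
  by (simp only: Union_quotient[OF equiv_undirected_connected])

lemma chain_components_disjoint:
  assumes "\<tau> \<in> chain_components V E" "\<rho> \<in> chain_components V E" "\<tau> \<noteq> \<rho>"
  shows "\<tau> \<inter> \<rho> = {}"
  using assms quotient_disj[OF equiv_undirected_connected[of V E], of \<tau> \<rho>]
  unfolding chain_components_def by simp

lemma chain_component_connected:
  assumes "\<tau> \<in> chain_components V E" "v \<in> \<tau>" "w \<in> \<tau>"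
  shows "(v, w) \<in> E\<^sup>*"
proof -
  have "(v, w) \<in> (undirected_edges E)\<^sup>*"
    using quotient_eq_iff[OF equiv_undirected_connected[of V E] _ _ assms(2,3)] assms(1)
    unfolding chain_components_def by simp
  moreover have "undirected_edges E \<subseteq> E"
    by (auto simp: undirected_edges_def)
  ultimately show ?thesis
    using rtrancl_mono by blast
qed

text \<open>Two opposite edges between components, connected by undirected paths inside the
  components, would yield a path back along a directed edge. The case of equal components excludes
  loops.\<close>

lemma component_dag_asym:
  assumes "chain_graph V E" "(\<rho>, \<tau>) \<in> component_dag V E"
  shows "(\<tau>, \<rho>) \<notin> component_dag V E"
proof
  assume "(\<tau>, \<rho>) \<in> component_dag V E"
  then obtain w' v' where 1: "w' \<in> \<tau>" "v' \<in> \<rho>" "(w', v') \<in> directed_edges E"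
    by (auto simp: component_dag_def)
  obtain v w where 2: "v \<in> \<rho>" "w \<in> \<tau>" "(v, w) \<in> directed_edges E"
    "\<rho> \<in> chain_components V E" "\<tau> \<in> chain_components V E"
    using assms(2) by (auto simp: component_dag_def)
  have "(w, w') \<in> E\<^sup>*" "(v', v) \<in> E\<^sup>*"
    using 1 2 by (blast intro: chain_component_connected)+
  moreover have "(w', v') \<in> E\<^sup>*"
    using 1(3) by (auto simp: directed_edges_def)
  ultimately have "(w, v) \<in> E\<^sup>*"
    by (blast intro: rtrancl_trans)
  then show False
    using chain_graph_no_path_back[OF assms(1) 2(3)] by simp
qed

section \<open>Parents and non-descendants of a component\<close>

lemma pa_D_subset: "pa_D V E \<tau> \<subseteq> V"
  unfolding pa_D_def component_dag_def by (intro Union_least) (auto dest: chain_component_subset)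

lemma nd_D_subset: "nd_D V E \<tau> \<subseteq> V"
  unfolding nd_D_def by (intro Union_least) (auto dest: chain_component_subset)

text \<open>Components are disjoint, so one that meets a union of components is a member of that
  union.\<close>

lemma meets_pa_D_imp_edge:
  assumes "\<tau> \<in> chain_components V E" "\<tau> \<inter> pa_D V E \<rho> \<noteq> {}"
  shows "(\<tau>, \<rho>) \<in> component_dag V E"
proof -
  obtain v \<tau>' where "v \<in> \<tau>" "v \<in> \<tau>'" and e: "(\<tau>', \<rho>) \<in> component_dag V E"
    using assms(2) by (auto simp: pa_D_def)
  moreover from e have "\<tau>' \<in> chain_components V E"
    by (simp add: component_dag_def)
  ultimately have "\<tau>' = \<tau>"
    using chain_components_disjoint[of \<tau>' V E \<tau>] assms(1) by blast
  with e show ?thesis by simp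
qed

lemma pa_D_disjoint:
  assumes "chain_graph V E" "\<tau> \<in> chain_components V E"
  shows "\<tau> \<inter> pa_D V E \<tau> = {}"
  using meets_pa_D_imp_edge[OF assms(2)] component_dag_asym[OF assms(1)] by blast

lemma nd_D_disjoint:
  assumes "\<tau> \<in> chain_components V E"
  shows "\<tau> \<inter> nd_D V E \<tau> = {}"
  using chain_components_disjoint[OF assms] unfolding nd_D_def by fast

text \<open>Here \<open>\<tau>\<close> is a child of \<open>\<rho>\<close>: the edge makes it a
  descendant, and asymmetry prevents it from being a parent. The Markov conditions of such a
  \<open>\<rho>\<close> therefore never compare it with the variables in
  \<open>\<tau>\<close>.\<close>

lemma child_disjoint_pa_D_nd_D:
  assumes "chain_graph V E" "\<tau> \<in> chain_components V E" "\<rho> \<in> chain_components V E"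
    and "\<rho> \<inter> pa_D V E \<tau> \<noteq> {}"
  shows "\<tau> \<inter> (nd_D V E \<rho> \<union> pa_D V E \<rho>) = {}"
proof -
  have e: "(\<rho>, \<tau>) \<in> component_dag V E"
    using meets_pa_D_imp_edge assms by blast
  then have "\<tau> \<inter> pa_D V E \<rho> = {}"
    using meets_pa_D_imp_edge[OF assms(2)] component_dag_asym[OF assms(1)] by blast
  moreover have "\<tau> \<inter> nd_D V E \<rho> = {}"
  proof (rule ccontr)
    assume "\<tau> \<inter> nd_D V E \<rho> \<noteq> {}"
    then obtain v \<rho>' where "v \<in> \<tau>" "v \<in> \<rho>'" "\<rho>' \<in> chain_components V E"
      "(\<rho>, \<rho>') \<notin> (component_dag V E)\<^sup>+"
      unfolding nd_D_def by blast
    moreover from this have "\<tau> = \<rho>'"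
      using chain_components_disjoint[OF assms(2), of \<rho>'] by blast
    ultimately show False
      using e by blast
  qed
  ultimately show ?thesis by blast
qed

text \<open>The undirected path from \<open>w\<close> to \<open>v\<close> inside the component would
  be a path back.\<close>

lemma directed_edge_notin_component:
  assumes "chain_graph V E" "\<tau> \<in> chain_components V E" "v \<in> \<tau>" "w \<in> \<tau>"
  shows "(v, w) \<notin> directed_edges E"
  using chain_graph_no_path_back[OF assms(1), of v w] chain_component_connected[OF assms(2,4,3)]
  by (intro notI) simp

lemma pa_subset_pa_D:
  assumes "chain_graph V E" "\<tau> \<in> chain_components V E" "\<sigma> \<subseteq> \<tau>"
  shows "pa E \<sigma> \<subseteq> pa_D V E \<tau>"
proof
  fix v assume "v \<in> pa E \<sigma>"
  then obtain w where w: "w \<in> \<sigma>" "(v, w) \<in> directed_edges E"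
    by (auto simp: pa_def)
  moreover have "E \<subseteq> V \<times> V"
    using assms(1) unfolding chain_graph_def graph_on_def by fast
  ultimately have "v \<in> V"
    by (auto simp: directed_edges_def)
  then have "v \<in> \<Union> (chain_components V E)"
    unfolding chain_components_def by (simp only: Union_quotient[OF equiv_undirected_connected])
  then obtain \<rho> where "\<rho> \<in> chain_components V E" "v \<in> \<rho>"
    by (rule UnionE)
  moreover have "w \<in> \<tau>"
    using assms(3) w(1) by blast
  ultimately have "(\<rho>, \<tau>) \<in> component_dag V E"
    using assms(2) w(2) by (auto simp: component_dag_def)
  with \<open>v \<in> \<rho>\<close> show "v \<in> pa_D V E \<tau>"
    unfolding pa_D_def by blast
qed

text \<open>Edges inside a component are undirected, so under completeness a single vertex of
  \<open>\<sigma>\<close> is already a neighbor of every vertex of \<open>\<tau>\<close> outside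
  \<open>\<sigma>\<close>.\<close>

lemma complete_component_Nb:
  assumes "chain_graph V E" "\<tau> \<in> chain_components V E" "complete_set E \<tau>"
    and "\<sigma> \<subseteq> \<tau>" "\<sigma> \<noteq> {}"
  shows "\<tau> - Nb E \<sigma> = {}"
proof -
  obtain s where s: "s \<in> \<sigma>" "s \<in> \<tau>"
    using assms(4,5) by auto
  have "v \<in> nb E \<sigma>" if v: "v \<in> \<tau>" "v \<notin> \<sigma>" for v
  proof -
    have "(v, s) \<in> E \<or> (s, v) \<in> E"
      using assms(3) s v unfolding complete_set_def by metis
    then have "(v, s) \<in> undirected_edges E"
      using directed_edge_notin_component[OF assms(1,2) v(1) s(2)]
        directed_edge_notin_component[OF assms(1,2) s(2) v(1)]
      by (auto simp: directed_edges_def undirected_edges_def)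
    then show ?thesis
      using v(2) s(1) by (auto simp: nb_def)
  qed
  then show ?thesis
    unfolding Nb_def by blast
qed

section \<open>Marginals and conditional independence\<close>

lemma restrict_Un_eq_iff:
  "restrict x (A \<union> B) = restrict y (A \<union> B) \<longleftrightarrow> restrict x A = restrict y A \<and> restrict x B = restrict y B"
  by (auto simp: restrict_def fun_eq_iff)

lemma restrict_eq_mono:
  assumes "restrict x B = restrict y B" "A \<subseteq> B"
  shows "restrict x A = restrict y A"
  using assms by (metis restrict_restrict Int_absorb1)

lemma finite_configs: "finite A \<Longrightarrow> finite (configs d A)"
  unfolding configs_def by (intro finite_PiE) auto

lemma restrict_in_configs: "x \<in> configs d B \<Longrightarrow> A \<subseteq> B \<Longrightarrow> restrict x A \<in> configs d A"
  by (auto simp: configs_def)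

lemma restrict_configs_id: "x \<in> configs d A \<Longrightarrow> restrict x A = x"
  by (simp add: configs_def PiE_restrict)

lemma merge_in_configs:
  assumes "a \<in> configs d A" "b \<in> configs d B"
  shows "merge A B (a, b) \<in> configs d (A \<union> B)"
  using assms by (auto simp: configs_def PiE_iff merge_def extensional_def)

lemma configs_nonempty:
  assumes "\<And>v. v \<in> A \<Longrightarrow> d v \<ge> 1"
  shows "configs d A \<noteq> {}"
  using assms by (fastforce simp: configs_def PiE_eq_empty_iff)

lemma configs_extend:
  assumes "a \<in> configs d A" "A \<subseteq> W" "\<And>v. v \<in> W \<Longrightarrow> d v \<ge> 1"
  obtains x where "x \<in> configs d W" "restrict x A = a"
proof -
  obtain b where "b \<in> configs d (W - A)"
    using configs_nonempty[of "W - A" d] assms(3) by blast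
  then have "merge A (W - A) (a, b) \<in> configs d W"
    using merge_in_configs[OF assms(1), of b "W - A"] assms(2) by (simp add: Un_absorb1)
  moreover have "restrict (merge A (W - A) (a, b)) A = a"
    using restrict_configs_id[OF assms(1)] by simp
  ultimately show ?thesis
    by (rule that)
qed

lemma sum_configs_Un:
  assumes "A \<inter> B = {}"
  shows "(\<Sum>x\<in>configs d (A \<union> B). f x) = (\<Sum>a\<in>configs d A. \<Sum>b\<in>configs d B. f (merge A B (a, b)))"
proof -
  have "(\<Sum>x\<in>configs d (A \<union> B). f x) = (\<Sum>ab\<in>configs d A \<times> configs d B. f (merge A B ab))"
  proof (rule sum.reindex_bij_witness[of _ "merge A B" "\<lambda>x. (restrict x A, restrict x B)"])
    fix x assume x: "x \<in> configs d (A \<union> B)"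
    show eq: "merge A B (restrict x A, restrict x B) = x"
      using restrict_configs_id[OF x] by simp
    then show "f (merge A B (restrict x A, restrict x B)) = f x"
      by simp
    show "(restrict x A, restrict x B) \<in> configs d A \<times> configs d B"
      using restrict_in_configs[OF x] by simp
  next
    fix ab assume "ab \<in> configs d A \<times> configs d B"
    then obtain a b where "ab = (a, b)" and ab: "a \<in> configs d A" "b \<in> configs d B"
      by blast
    with assms show "(restrict (merge A B ab) A, restrict (merge A B ab) B) = ab"
      "merge A B ab \<in> configs d (A \<union> B)"
      using restrict_configs_id[OF ab(1)] restrict_configs_id[OF ab(2)] merge_in_configs[OF ab] by simp_all
  qed
  then show ?thesis
    by (simp add: sum.cartesian_product)
qed

text \<open>A weight that ignores the coordinates in \<open>\<sigma>\<close> makes them uniform and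
  independent of the others. The identity is multiplied by the number of states of
  \<open>\<sigma>\<close> to avoid division; \<open>of_bool\<close> covers arguments
  \<open>i\<close> whose \<open>\<sigma>\<close>-part is not a state.\<close>

lemma sum_configs_factor:
  fixes f :: "('v \<Rightarrow> nat) \<Rightarrow> real"
  assumes "finite W" "\<sigma> \<subseteq> W" "B \<subseteq> W - \<sigma>"
    and f: "\<And>x y. restrict x (W - \<sigma>) = restrict y (W - \<sigma>) \<Longrightarrow> f x = f y"
  shows "of_nat (card (configs d \<sigma>)) *
      (\<Sum>x\<in>configs d W. if restrict x (\<sigma> \<union> B) = restrict i (\<sigma> \<union> B) then f x else 0) =
    of_bool (restrict i \<sigma> \<in> configs d \<sigma>) *
      (\<Sum>x\<in>configs d W. if restrict x B = restrict i B then f x else 0)"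
proof -
  \<comment> \<open>Fixing the \<open>\<sigma>\<close>-coordinates at a state leaves
    \<open>F\<close> once, while leaving them free repeats it once for every state of
    \<open>\<sigma>\<close>.\<close>
  define F where "F = (\<Sum>z\<in>configs d (W - \<sigma>). if restrict z B = restrict i B then f z else 0)"
  have W: "W = \<sigma> \<union> (W - \<sigma>)"
    using assms(2) by blast
  have fin: "finite (configs d \<sigma>)"
    using assms(1,2) finite_subset by (blast intro: finite_configs)
  have res: "restrict (merge \<sigma> (W - \<sigma>) (s, z)) B = restrict z B" for s z :: "'v \<Rightarrow> nat"
    using restrict_eq_mono[OF restrict_merge(2) assms(3), of \<sigma> s z] by blast
  have fz: "f (merge \<sigma> (W - \<sigma>) (s, z)) = f z" for s z
    by (intro f) simp
  have "(\<Sum>x\<in>configs d W. if restrict x (\<sigma> \<union> B) = restrict i (\<sigma> \<union> B) then f x else 0) =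
    (\<Sum>s\<in>configs d \<sigma>. \<Sum>z\<in>configs d (W - \<sigma>). if s = restrict i \<sigma> then (if restrict z B = restrict i B then f z else 0) else 0)"
    by (subst W, subst sum_configs_Un)
      (auto simp: restrict_Un_eq_iff res fz restrict_configs_id intro!: sum.cong)
  also have "\<dots> = (\<Sum>s\<in>configs d \<sigma>. if s = restrict i \<sigma> then F else 0)"
    unfolding F_def by (intro sum.cong) auto
  also have "\<dots> = of_bool (restrict i \<sigma> \<in> configs d \<sigma>) * F"
    using fin by (simp add: sum.delta)
  finally have 1: "(\<Sum>x\<in>configs d W. if restrict x (\<sigma> \<union> B) = restrict i (\<sigma> \<union> B) then f x else 0) =
    of_bool (restrict i \<sigma> \<in> configs d \<sigma>) * F" .
  have "(\<Sum>x\<in>configs d W. if restrict x B = restrict i B then f x else 0) = (\<Sum>s\<in>configs d \<sigma>. F)"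
    unfolding F_def by (subst W, subst sum_configs_Un) (auto simp: res fz cong: if_cong)
  then show ?thesis
    using 1 by simp
qed

section \<open>Marginal probabilities and conditional independence\<close>

definition marginal :: "('v \<Rightarrow> nat) pmf \<Rightarrow> 'v set \<Rightarrow> ('v \<Rightarrow> nat) \<Rightarrow> real" where
  "marginal p A i = measure_pmf.prob p {x. restrict x A = restrict i A}"

lemma marginal_cong: "restrict i A = restrict j A \<Longrightarrow> marginal p A i = marginal p A j"
  by (simp add: marginal_def)

lemma marginal_mono: "A \<subseteq> B \<Longrightarrow> marginal p B i \<le> marginal p A i"
  unfolding marginal_def by (intro measure_pmf.finite_measure_mono) (auto dest: restrict_eq_mono)

lemma cond_prob_restrict:
  "\<P>(x in measure_pmf p. restrict x A = restrict i A \<bar> restrict x B = restrict i B) =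
     marginal p (A \<union> B) i / marginal p B i"
  by (simp add: cond_prob_def marginal_def restrict_Un_eq_iff)

text \<open>The denominators are cleared. If the conditioning event has probability zero, the
  marginals over larger index sets vanish too, and both forms of the equation read
  \<open>0 = 0\<close>. All marginals are evaluated at one common \<open>i\<close>, of which each
  sees only its own coordinates.\<close>

lemma cond_indep_iff_marginal:
  "cond_indep p \<alpha> \<beta> \<gamma> \<longleftrightarrow>
     (\<forall>i. marginal p (\<alpha> \<union> \<beta> \<union> \<gamma>) i * marginal p \<gamma> i = marginal p (\<alpha> \<union> \<gamma>) i * marginal p (\<beta> \<union> \<gamma>) i)"
proof -
  have eq: "\<P>(x in measure_pmf p. restrict x \<alpha> = restrict i \<alpha> \<and> restrict x \<beta> = restrict i \<beta>
      \<bar> restrict x \<gamma> = restrict i \<gamma>) = marginal p (\<alpha> \<union> \<beta> \<union> \<gamma>) i / marginal p \<gamma> i" for i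
    using cond_prob_restrict[of p "\<alpha> \<union> \<beta>" i \<gamma>] by (simp add: restrict_Un_eq_iff)
  have "marginal p (\<alpha> \<union> \<beta> \<union> \<gamma>) i / marginal p \<gamma> i =
      marginal p (\<alpha> \<union> \<gamma>) i / marginal p \<gamma> i * (marginal p (\<beta> \<union> \<gamma>) i / marginal p \<gamma> i) \<longleftrightarrow>
    marginal p (\<alpha> \<union> \<beta> \<union> \<gamma>) i * marginal p \<gamma> i = marginal p (\<alpha> \<union> \<gamma>) i * marginal p (\<beta> \<union> \<gamma>) i" for i
  proof (cases "marginal p \<gamma> i = 0")
    case True
    then have "marginal p (\<alpha> \<union> \<gamma>) i = 0"
      using marginal_mono[of \<gamma> "\<alpha> \<union> \<gamma>" p i] by (simp add: marginal_def measure_le_0_iff)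
    with True show ?thesis by simp
  qed (simp add: field_simps)
  then show ?thesis
    unfolding cond_indep_def eq cond_prob_restrict by simp
qed

lemma cond_indep_empty: "cond_indep p {} \<beta> \<gamma>" "cond_indep p \<alpha> {} \<gamma>"
  by (simp_all add: cond_indep_iff_marginal)

lemma prob_eq_sum_configs:
  assumes "finite V" "p \<in> open_simplex V d"
  shows "measure_pmf.prob p S = (\<Sum>x\<in>configs d V. if x \<in> S then pmf p x else 0)"
proof -
  have "measure_pmf.prob p S = measure_pmf.prob p (S \<inter> configs d V)"
    using assms(2) by (intro measure_pmf.finite_measure_eq_AE) (auto simp: open_simplex_def AE_measure_pmf_iff)
  also have "\<dots> = (\<Sum>x\<in>S \<inter> configs d V. pmf p x)"
    using assms(1) by (intro measure_measure_pmf_finite) (simp add: finite_configs)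
  also have "\<dots> = (\<Sum>x\<in>configs d V. if x \<in> S then pmf p x else 0)"
    using assms(1) by (intro sum.mono_neutral_cong_left) (auto simp: finite_configs)
  finally show ?thesis .
qed

lemma marginal_pos:
  assumes "p \<in> open_simplex V d" "x \<in> configs d V"
  shows "marginal p A x > 0"
proof -
  have "0 < pmf p x"
    using assms by (simp add: open_simplex_def pmf_positive)
  also have "pmf p x = measure_pmf.prob p {x}"
    by (simp add: measure_pmf_single)
  also have "\<dots> \<le> marginal p A x"
    unfolding marginal_def by (intro measure_pmf.finite_measure_mono) auto
  finally show ?thesis .
qed

text \<open>Up to a null set, the events fixing the whole \<open>\<tau>\<close>-part partition the
  event fixing its \<open>\<sigma>\<close>-part. Partial sums of an array are thus conditional
  marginals.\<close>

lemma sum_cond_prob_configs: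
  assumes "finite V" "p \<in> open_simplex V d" "\<sigma> \<subseteq> \<tau>" "\<tau> \<subseteq> V"
  shows "(\<Sum>a\<in>{a \<in> configs d \<tau>. restrict a \<sigma> = s}. \<P>(x in measure_pmf p. restrict x \<tau> = a \<bar> Q x)) =
    \<P>(x in measure_pmf p. restrict x \<sigma> = s \<bar> Q x)"
proof -
  have "(\<Sum>a\<in>{a \<in> configs d \<tau>. restrict a \<sigma> = s}. measure_pmf.prob p {x. restrict x \<tau> = a \<and> Q x}) =
    measure_pmf.prob p (\<Union>a\<in>{a \<in> configs d \<tau>. restrict a \<sigma> = s}. {x. restrict x \<tau> = a \<and> Q x})"
    using finite_configs[OF finite_subset[OF assms(4,1)], of d]
    by (intro measure_pmf.finite_measure_finite_Union[symmetric]) (auto simp: disjoint_family_on_def)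
  also have "\<dots> = measure_pmf.prob p {x. restrict x \<sigma> = s \<and> Q x}"
  proof (intro measure_pmf.finite_measure_eq_AE)
    have "restrict x \<tau> \<in> configs d \<tau>" if "x \<in> configs d V" for x
      using that assms(4) by (rule restrict_in_configs)
    moreover have "restrict (restrict x \<tau>) \<sigma> = restrict x \<sigma>" for x :: "'a \<Rightarrow> nat"
      using assms(3) by (simp add: Int_absorb1)
    ultimately show "AE x in measure_pmf p.
        (x \<in> (\<Union>a\<in>{a \<in> configs d \<tau>. restrict a \<sigma> = s}. {x. restrict x \<tau> = a \<and> Q x})) =
        (x \<in> {x. restrict x \<sigma> = s \<and> Q x})"
      using assms(2) by (auto simp: AE_measure_pmf_iff open_simplex_def)
  qed simp_all
  finally show ?thesis
    by (simp add: cond_prob_def sum_divide_distrib[symmetric])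
qed

section \<open>The distribution realizing an array\<close>

text \<open>This is condition (C3b) expressed by the array: the conditional marginal of
  \<open>\<sigma>\<close> depends on the state of \<open>P\<close> only through
  \<open>\<gamma>\<close>. It is linear in \<open>\<theta>\<close>. An \<open>s\<close> that is no
  restriction of a state gives empty sums on both sides.\<close>

definition marginal_invariant ::
  "('v \<Rightarrow> nat) \<Rightarrow> 'v set \<Rightarrow> 'v set \<Rightarrow> (('v \<Rightarrow> nat) \<times> ('v \<Rightarrow> nat) \<Rightarrow> real) \<Rightarrow> 'v set \<Rightarrow> 'v set \<Rightarrow> bool"
where
  "marginal_invariant d \<tau> P \<theta> \<sigma> \<gamma> \<longleftrightarrow>
    (\<forall>s. \<forall>b\<in>configs d P. \<forall>b'\<in>configs d P. restrict b \<gamma> = restrict b' \<gamma> \<longrightarrow>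
      (\<Sum>a\<in>{a \<in> configs d \<tau>. restrict a \<sigma> = s}. \<theta> (a, b)) =
      (\<Sum>a\<in>{a \<in> configs d \<tau>. restrict a \<sigma> = s}. \<theta> (a, b')))"

text \<open>The graph is left out: \<open>P\<close> is any set outside \<open>\<tau>\<close>, and
  the independences below follow from the relative position of index sets and from invariance of the
  array.\<close>

locale component_array =
  fixes V \<tau> P :: "'v set" and d :: "'v \<Rightarrow> nat" and \<theta> :: "('v \<Rightarrow> nat) \<times> ('v \<Rightarrow> nat) \<Rightarrow> real"
  assumes finite_V: "finite V" and \<tau>_subset: "\<tau> \<subseteq> V" and P_subset: "P \<subseteq> V - \<tau>"
    and d_ge_1: "\<And>v. v \<in> V \<Longrightarrow> d v \<ge> 1"
    and \<theta>_pos: "\<And>a b. a \<in> configs d \<tau> \<Longrightarrow> b \<in> configs d P \<Longrightarrow> \<theta> (a, b) > 0"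
    and \<theta>_sum: "\<And>b. b \<in> configs d P \<Longrightarrow> (\<Sum>a\<in>configs d \<tau>. \<theta> (a, b)) = 1"
begin

text \<open>The reciprocal of the divisor is the uniform density of the variables outside
  \<open>\<tau>\<close>.\<close>

definition weight :: "('v \<Rightarrow> nat) \<Rightarrow> real" where
  "weight x = \<theta> (restrict x \<tau>, restrict x P) / card (configs d (V - \<tau>))"

definition joint :: "('v \<Rightarrow> nat) pmf" where
  "joint = embed_pmf (\<lambda>x. if x \<in> configs d V then weight x else 0)"

lemma card_rest_pos: "card (configs d (V - \<tau>)) > 0"
  using configs_nonempty[of "V - \<tau>" d] finite_configs[of "V - \<tau>" d] finite_V d_ge_1
  by (simp add: card_gt_0_iff)

lemma weight_pos: "x \<in> configs d V \<Longrightarrow> weight x > 0"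
  unfolding weight_def using card_rest_pos \<tau>_subset P_subset
  by (intro divide_pos_pos \<theta>_pos restrict_in_configs[of x d V]) auto

text \<open>The coordinates in \<open>\<tau>\<close> are summed first, with those outside held at
  \<open>y\<close>. Trivial predicates give the normalization, equalities of restrictions give the
  marginals.\<close>

lemma sum_weight_split:
  "(\<Sum>x\<in>configs d V. if R (restrict x \<tau>) \<and> S (restrict x (V - \<tau>)) then weight x else 0) =
    (\<Sum>y\<in>configs d (V - \<tau>). if S y
       then (\<Sum>a\<in>{a \<in> configs d \<tau>. R a}. \<theta> (a, restrict y P)) / card (configs d (V - \<tau>)) else 0)"
proof -
  have V: "V = \<tau> \<union> (V - \<tau>)"
    using \<tau>_subset by blast
  have fin: "finite (configs d \<tau>)"
    using finite_configs finite_subset[OF \<tau>_subset finite_V] by blast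
  have res: "restrict (merge \<tau> (V - \<tau>) (a, y)) P = restrict y P" for a y :: "'v \<Rightarrow> nat"
    using restrict_eq_mono[OF restrict_merge(2) P_subset, of \<tau> a y] by blast
  have w: "weight (merge \<tau> (V - \<tau>) (a, y)) = \<theta> (a, restrict y P) / card (configs d (V - \<tau>))"
    if "a \<in> configs d \<tau>" for a y
    using restrict_configs_id[OF that] by (simp add: weight_def res)
  have "(\<Sum>x\<in>configs d V. if R (restrict x \<tau>) \<and> S (restrict x (V - \<tau>)) then weight x else 0) =
    (\<Sum>a\<in>configs d \<tau>. \<Sum>y\<in>configs d (V - \<tau>). if R a \<and> S y then \<theta> (a, restrict y P) / card (configs d (V - \<tau>)) else 0)"
    by (subst V, subst sum_configs_Un) (auto simp: w restrict_configs_id intro!: sum.cong)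
  also have "\<dots> = (\<Sum>y\<in>configs d (V - \<tau>). \<Sum>a\<in>configs d \<tau>. if R a \<and> S y then \<theta> (a, restrict y P) / card (configs d (V - \<tau>)) else 0)"
    by (rule sum.swap)
  also have "\<dots> = (\<Sum>y\<in>configs d (V - \<tau>). if S y
       then (\<Sum>a\<in>{a \<in> configs d \<tau>. R a}. \<theta> (a, restrict y P)) / card (configs d (V - \<tau>)) else 0)"
    using fin by (intro sum.cong) (auto simp: sum_divide_distrib sum.inter_filter intro!: sum.cong)
  finally show ?thesis .
qed

lemma sum_weight: "(\<Sum>x\<in>configs d V. weight x) = 1"
proof -
  have "(\<Sum>a\<in>configs d \<tau>. \<theta> (a, restrict y P)) = 1" if "y \<in> configs d (V - \<tau>)" for y
    using \<theta>_sum restrict_in_configs[OF that P_subset] by blast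
  then show ?thesis
    using sum_weight_split[of "\<lambda>_. True" "\<lambda>_. True"] card_rest_pos by simp
qed

lemma pmf_joint: "pmf joint x = (if x \<in> configs d V then weight x else 0)"
  unfolding joint_def
proof (rule pmf_embed_pmf)
  have "(\<integral>\<^sup>+x. ennreal (if x \<in> configs d V then weight x else 0) \<partial>count_space UNIV) =
    (\<Sum>x\<in>configs d V. ennreal (weight x))"
    using finite_configs[OF finite_V]
    by (subst nn_integral_count_space'[of "configs d V"]) auto
  also have "\<dots> = ennreal (\<Sum>x\<in>configs d V. weight x)"
    by (intro sum_ennreal) (auto dest: weight_pos)
  finally show "(\<integral>\<^sup>+x. ennreal (if x \<in> configs d V then weight x else 0) \<partial>count_space UNIV) = 1"
    by (simp add: sum_weight)
qed (auto dest: weight_pos)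

lemma joint_in_open_simplex: "joint \<in> open_simplex V d"
  using weight_pos by (force simp: open_simplex_def set_pmf_eq pmf_joint)

section \<open>Marginals and independences of the constructed distribution\<close>

lemma marginal_joint:
  "marginal joint A i = (\<Sum>x\<in>configs d V. if restrict x A = restrict i A then weight x else 0)"
  unfolding marginal_def prob_eq_sum_configs[OF finite_V joint_in_open_simplex]
  by (intro sum.cong) (auto simp: pmf_joint)

lemma marginal_joint_Un:
  assumes "\<sigma> \<subseteq> \<tau>" "B \<subseteq> V - \<tau>"
  shows "marginal joint (\<sigma> \<union> B) i =
    (\<Sum>y\<in>configs d (V - \<tau>). if restrict y B = restrict i B
       then (\<Sum>a\<in>{a \<in> configs d \<tau>. restrict a \<sigma> = restrict i \<sigma>}. \<theta> (a, restrict y P)) /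
         card (configs d (V - \<tau>)) else 0)"
proof -
  have "restrict (restrict x \<tau>) \<sigma> = restrict x \<sigma>" "restrict (restrict x (V - \<tau>)) B = restrict x B"
    for x :: "'v \<Rightarrow> nat"
    using assms by (simp_all add: Int_absorb1)
  then show ?thesis
    unfolding sum_weight_split[symmetric] marginal_joint restrict_Un_eq_iff by simp
qed

lemma marginal_joint_rest:
  assumes "B \<subseteq> V - \<tau>"
  shows "marginal joint B i =
    (\<Sum>y\<in>configs d (V - \<tau>). if restrict y B = restrict i B then 1 / card (configs d (V - \<tau>)) else 0)"
proof -
  have "(\<Sum>a\<in>configs d \<tau>. \<theta> (a, restrict y P)) = 1" if "y \<in> configs d (V - \<tau>)" for y
    using \<theta>_sum restrict_in_configs[OF that P_subset] by blast
  then show ?thesis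
    using marginal_joint_Un[of "{}" B i] assms by (auto simp: restrict_def intro!: sum.cong)
qed

text \<open>By invariance the inner sum over \<open>\<tau>\<close> is the same for every
  \<open>y\<close> compatible with \<open>i\<close>, so its value at the representative
  \<open>b0\<close> can be pulled out. This factor does not depend on \<open>B\<close>.\<close>

lemma marginal_joint_component:
  assumes "\<sigma> \<subseteq> \<tau>" "\<gamma> \<subseteq> P" "\<gamma> \<subseteq> B" "B \<subseteq> V - \<tau>" "marginal_invariant d \<tau> P \<theta> \<sigma> \<gamma>"
    and b0: "b0 \<in> configs d P" "restrict b0 \<gamma> = restrict i \<gamma>"
  shows "marginal joint (\<sigma> \<union> B) i =
    (\<Sum>a\<in>{a \<in> configs d \<tau>. restrict a \<sigma> = restrict i \<sigma>}. \<theta> (a, b0)) * marginal joint B i"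
proof -
  have eq: "(\<Sum>a\<in>{a \<in> configs d \<tau>. restrict a \<sigma> = restrict i \<sigma>}. \<theta> (a, restrict y P)) =
    (\<Sum>a\<in>{a \<in> configs d \<tau>. restrict a \<sigma> = restrict i \<sigma>}. \<theta> (a, b0))"
    if y: "y \<in> configs d (V - \<tau>)" "restrict y B = restrict i B" for y
  proof -
    have "restrict (restrict y P) \<gamma> = restrict b0 \<gamma>"
      using restrict_eq_mono[OF y(2) assms(3)] b0(2) assms(2) by (simp add: Int_absorb1)
    then show ?thesis
      using assms(5) restrict_in_configs[OF y(1) P_subset] b0(1) unfolding marginal_invariant_def by blast
  qed
  show ?thesis
    unfolding marginal_joint_Un[OF assms(1,4)] marginal_joint_rest[OF assms(4)] sum_distrib_left
    by (intro sum.cong) (auto simp: eq)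
qed

text \<open>The sets \<open>\<beta> \<union> \<gamma>\<close> and \<open>\<gamma>\<close> in the
  role of \<open>B\<close> produce the same factor, so the two products agree.\<close>

lemma cond_indep_component:
  assumes "\<sigma> \<subseteq> \<tau>" "\<gamma> \<subseteq> P" "\<beta> \<subseteq> V - \<tau>" "marginal_invariant d \<tau> P \<theta> \<sigma> \<gamma>"
  shows "cond_indep joint \<sigma> \<beta> \<gamma>"
  unfolding cond_indep_iff_marginal
proof
  fix i
  have \<gamma>: "\<gamma> \<subseteq> V - \<tau>"
    using assms(2) P_subset by blast
  show "marginal joint (\<sigma> \<union> \<beta> \<union> \<gamma>) i * marginal joint \<gamma> i =
    marginal joint (\<sigma> \<union> \<gamma>) i * marginal joint (\<beta> \<union> \<gamma>) i"
  proof (cases "\<exists>b0\<in>configs d P. restrict b0 \<gamma> = restrict i \<gamma>")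
    case True
    then obtain b0 where b0: "b0 \<in> configs d P" "restrict b0 \<gamma> = restrict i \<gamma>"
      by blast
    show ?thesis
      using marginal_joint_component[OF assms(1,2) _ _ assms(4) b0, of "\<beta> \<union> \<gamma>"]
        marginal_joint_component[OF assms(1,2) _ _ assms(4) b0, of \<gamma>] assms(3) \<gamma>
      by (simp add: Un_assoc)
  next
    \<comment> \<open>No state of \<open>P\<close> agrees with \<open>i\<close> on
      \<open>\<gamma>\<close>, so the conditioning event has probability zero and both products
      vanish.\<close>
    case False
    have "restrict y \<gamma> \<noteq> restrict i \<gamma>" if "y \<in> configs d (V - \<tau>)" for y
    proof -
      have "restrict (restrict y P) \<gamma> = restrict y \<gamma>"
        using assms(2) by (simp add: Int_absorb1)
      then show ?thesis
        using False restrict_in_configs[OF that P_subset] by metis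
    qed
    then have "marginal joint \<gamma> i = 0"
      unfolding marginal_joint_rest[OF \<gamma>] by (intro sum.neutral) auto
    moreover from this have "marginal joint (\<sigma> \<union> \<gamma>) i = 0"
      using marginal_mono[of \<gamma> "\<sigma> \<union> \<gamma>" joint i] by (simp add: marginal_def measure_le_0_iff)
    ultimately show ?thesis by simp
  qed
qed

text \<open>If \<open>B\<close> avoids \<open>\<tau>\<close>, only the uniform variables outside
  \<open>\<tau>\<close> are involved; if \<open>\<sigma>\<close> avoids \<open>P\<close>, the weight
  ignores the coordinates in \<open>\<sigma>\<close>. Either way \<open>\<sigma>\<close> contributes
  a uniform factor.\<close>

lemma marginal_joint_factor:
  assumes "\<sigma> \<subseteq> V - \<tau>" "B \<subseteq> V - \<sigma>" "\<tau> \<inter> B = {} \<or> \<sigma> \<inter> P = {}"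
  shows "real (card (configs d \<sigma>)) * marginal joint (\<sigma> \<union> B) i =
    of_bool (restrict i \<sigma> \<in> configs d \<sigma>) * marginal joint B i"
  using assms(3)
proof
  assume "\<tau> \<inter> B = {}"
  then have "B \<subseteq> V - \<tau> - \<sigma>" "B \<subseteq> V - \<tau>" "\<sigma> \<union> B \<subseteq> V - \<tau>"
    using assms(1,2) by auto
  then show ?thesis
    using sum_configs_factor[of "V - \<tau>" \<sigma> B "\<lambda>_. 1 / card (configs d (V - \<tau>))" d i] finite_V assms(1)
    by (simp add: marginal_joint_rest)
next
  assume "\<sigma> \<inter> P = {}"
  then have sub: "\<tau> \<subseteq> V - \<sigma>" "P \<subseteq> V - \<sigma>"
    using assms(1) \<tau>_subset P_subset by auto
  have "weight x = weight y" if "restrict x (V - \<sigma>) = restrict y (V - \<sigma>)" for x y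
    using restrict_eq_mono[OF that sub(1)] restrict_eq_mono[OF that sub(2)] by (simp add: weight_def)
  then show ?thesis
    using sum_configs_factor[of V \<sigma> B weight d i] finite_V assms(1,2) unfolding marginal_joint by blast
qed

text \<open>The uniform factor of \<open>\<sigma>\<close> is the same next to
  \<open>\<beta> \<union> \<gamma>\<close> as next to \<open>\<gamma>\<close>.\<close>

lemma cond_indep_rest:
  assumes "\<sigma> \<subseteq> V - \<tau>" "\<beta> \<subseteq> V - \<sigma>" "\<gamma> \<subseteq> V - \<sigma>" "\<tau> \<inter> (\<beta> \<union> \<gamma>) = {} \<or> \<sigma> \<inter> P = {}"
  shows "cond_indep joint \<sigma> \<beta> \<gamma>"
  unfolding cond_indep_iff_marginal
proof
  fix i
  have "finite (configs d \<sigma>)" "configs d \<sigma> \<noteq> {}"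
    using assms(1) finite_V d_ge_1 by (auto intro!: finite_configs configs_nonempty dest: finite_subset)
  then have c: "card (configs d \<sigma>) > 0"
    by (simp add: card_gt_0_iff)
  have *: "marginal joint (\<sigma> \<union> B) i =
      of_bool (restrict i \<sigma> \<in> configs d \<sigma>) / card (configs d \<sigma>) * marginal joint B i"
    if "B \<subseteq> \<beta> \<union> \<gamma>" for B
  proof -
    have "B \<subseteq> V - \<sigma>" "\<tau> \<inter> B = {} \<or> \<sigma> \<inter> P = {}"
      using that assms(2-4) by blast+
    then show ?thesis
      using marginal_joint_factor[OF assms(1), of B i] c by (simp add: field_simps)
  qed
  show "marginal joint (\<sigma> \<union> \<beta> \<union> \<gamma>) i * marginal joint \<gamma> i =
    marginal joint (\<sigma> \<union> \<gamma>) i * marginal joint (\<beta> \<union> \<gamma>) i"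
    using *[of "\<beta> \<union> \<gamma>"] *[of \<gamma>] by (simp add: Un_assoc)
qed

text \<open>This is \<open>marginal_joint_component\<close> with \<open>\<sigma> = \<tau>\<close>
  and \<open>\<gamma> = B = P\<close>, where invariance is trivial and the sum reduces to the entry
  at \<open>a\<close>.\<close>

lemma cond_prob_joint:
  assumes "a \<in> configs d \<tau>" "b \<in> configs d P"
  shows "\<P>(x in measure_pmf joint. restrict x \<tau> = a \<bar> restrict x P = b) = \<theta> (a, b)"
proof -
  have \<tau>P: "\<tau> \<inter> P = {}" "P \<subseteq> V - \<tau>" "\<tau> \<union> P \<subseteq> V"
    using P_subset \<tau>_subset by auto
  obtain x where x: "x \<in> configs d V" "restrict x (\<tau> \<union> P) = merge \<tau> P (a, b)"
    using configs_extend[OF merge_in_configs[OF assms] \<tau>P(3)] d_ge_1 by blast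
  have xa: "restrict x \<tau> = a" "restrict x P = b"
    using arg_cong[OF x(2), of "\<lambda>z. restrict z \<tau>"] arg_cong[OF x(2), of "\<lambda>z. restrict z P"] \<tau>P
      restrict_configs_id[OF assms(1)] restrict_configs_id[OF assms(2)]
    by (simp_all add: Int_absorb1)
  have "marginal_invariant d \<tau> P \<theta> \<tau> P"
    by (auto simp: marginal_invariant_def restrict_configs_id)
  then have "marginal joint (\<tau> \<union> P) x = (\<Sum>a'\<in>{a' \<in> configs d \<tau>. restrict a' \<tau> = a}. \<theta> (a', b)) * marginal joint P x"
    using marginal_joint_component[of \<tau> P P b x] assms(2) xa \<tau>P(2) restrict_configs_id[OF assms(2)] by simp
  also have "{a' \<in> configs d \<tau>. restrict a' \<tau> = a} = {a}"
    using assms(1) by (auto simp: restrict_configs_id)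
  finally have "marginal joint (\<tau> \<union> P) x = \<theta> (a, b) * marginal joint P x"
    by simp
  then show ?thesis
    using cond_prob_restrict[of joint \<tau> x P] marginal_pos[OF joint_in_open_simplex x(1), of P] xa by simp
qed

end

section \<open>The set of arrays of the model\<close>

text \<open>These are the affine constraints; the strict inequalities are kept apart so that the set
  is closed.\<close>

definition linear_arrays ::
  "'v set \<Rightarrow> ('v \<times> 'v) set \<Rightarrow> ('v \<Rightarrow> nat) \<Rightarrow> 'v set \<Rightarrow> (('v \<Rightarrow> nat) \<times> ('v \<Rightarrow> nat) \<Rightarrow> real) set" where
  "linear_arrays V E d \<tau> = {\<theta> \<in> extensional (configs d \<tau> \<times> configs d (pa_D V E \<tau>)).
     (\<forall>b\<in>configs d (pa_D V E \<tau>). (\<Sum>a\<in>configs d \<tau>. \<theta> (a, b)) = 1) \<and>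
     (\<forall>\<sigma>\<subseteq>\<tau>. marginal_invariant d \<tau> (pa_D V E \<tau>) \<theta> \<sigma> (pa E \<sigma>))}"

lemma closed_linear_arrays: "closed (linear_arrays V E d \<tau>)"
proof -
  have eval: "continuous_on UNIV (\<lambda>\<theta>. (\<theta> x :: real))" for x :: "('v \<Rightarrow> nat) \<times> ('v \<Rightarrow> nat)"
    by (rule continuous_on_product_coordinates)
  show ?thesis
    unfolding linear_arrays_def marginal_invariant_def extensional_def Ball_def mem_Collect_eq
    by (intro closed_Collect_conj closed_Collect_all closed_Collect_imp open_Collect_const
        closed_Collect_eq continuous_on_sum eval continuous_on_const)
qed

lemma convex_combination_linear_arrays:
  assumes "\<theta> \<in> linear_arrays V E d \<tau>" "\<theta>' \<in> linear_arrays V E d \<tau>"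
  shows "(\<lambda>x. (1 - t) * \<theta> x + t * \<theta>' x) \<in> linear_arrays V E d \<tau>"
proof -
  have sum: "(\<Sum>a\<in>T. (1 - t) * \<theta> (a, b) + t * \<theta>' (a, b)) =
      (1 - t) * (\<Sum>a\<in>T. \<theta> (a, b)) + t * (\<Sum>a\<in>T. \<theta>' (a, b))" for T b
    by (simp add: sum.distrib sum_distrib_left)
  \<comment> \<open>Outside the index set both arrays equal the same constant
    \<open>undefined\<close>, which weights adding up to 1 preserve.\<close>
  have "(\<lambda>x. (1 - t) * \<theta> x + t * \<theta>' x) \<in> extensional (configs d \<tau> \<times> configs d (pa_D V E \<tau>))"
    using assms by (simp add: linear_arrays_def extensional_def left_diff_distrib)
  moreover have "marginal_invariant d \<tau> P (\<lambda>x. (1 - t) * \<theta> x + t * \<theta>' x) \<sigma> \<gamma>"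
    if "marginal_invariant d \<tau> P \<theta> \<sigma> \<gamma>" "marginal_invariant d \<tau> P \<theta>' \<sigma> \<gamma>" for P \<sigma> \<gamma>
    unfolding marginal_invariant_def sum
  proof (intro allI ballI impI)
    fix s b b' assume b: "b \<in> configs d P" "b' \<in> configs d P" "restrict b \<gamma> = restrict b' \<gamma>"
    have eq: "(\<Sum>a\<in>{a \<in> configs d \<tau>. restrict a \<sigma> = s}. \<eta> (a, b)) =
        (\<Sum>a\<in>{a \<in> configs d \<tau>. restrict a \<sigma> = s}. \<eta> (a, b'))"
      if "marginal_invariant d \<tau> P \<eta> \<sigma> \<gamma>" for \<eta>
      using that b unfolding marginal_invariant_def by blast
    show "(1 - t) * (\<Sum>a\<in>{a \<in> configs d \<tau>. restrict a \<sigma> = s}. \<theta> (a, b)) +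
        t * (\<Sum>a\<in>{a \<in> configs d \<tau>. restrict a \<sigma> = s}. \<theta>' (a, b)) =
      (1 - t) * (\<Sum>a\<in>{a \<in> configs d \<tau>. restrict a \<sigma> = s}. \<theta> (a, b')) +
        t * (\<Sum>a\<in>{a \<in> configs d \<tau>. restrict a \<sigma> = s}. \<theta>' (a, b'))"
      unfolding eq[OF that(1)] eq[OF that(2)] by (rule refl)
  qed
  ultimately show ?thesis
    using assms unfolding linear_arrays_def by (simp add: sum)
qed

text \<open>Partial sums of the array are conditional probabilities of \<open>\<sigma>\<close> given
  all of \<open>pa_D\<close>, and (C3b) replaces this condition by one on
  \<open>pa E \<sigma>\<close>. Positivity comes from the full support of \<open>p\<close>.\<close>

lemma cond_array_linear:
  assumes "chain_graph V E" "\<tau> \<in> chain_components V E" "p \<in> P_IV V E d"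
    and d: "\<And>v. v \<in> V \<Longrightarrow> d v \<ge> 1"
  shows "cond_array V E d \<tau> p \<in> linear_arrays V E d \<tau>"
    and "a \<in> configs d \<tau> \<Longrightarrow> b \<in> configs d (pa_D V E \<tau>) \<Longrightarrow> cond_array V E d \<tau> p (a, b) > 0"
proof -
  define P where "P = pa_D V E \<tau>"
  have fin: "finite V"
    using assms(1) by (simp add: chain_graph_def graph_on_def)
  have \<tau>: "\<tau> \<subseteq> V"
    by (rule chain_component_subset[OF assms(2)])
  have P: "P \<subseteq> V" "\<tau> \<inter> P = {}"
    unfolding P_def by (rule pa_D_subset, rule pa_D_disjoint[OF assms(1,2)])
  have p: "p \<in> open_simplex V d"
    using assms(3) by (simp add: P_IV_def)
  \<comment> \<open>A pair of states is realized by a state of all variables, where every marginal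
    of \<open>p\<close> is positive and may be divided by.\<close>
  have lift: "\<exists>x\<in>configs d V. restrict x \<tau> = a \<and> restrict x P = b"
    if ab: "a \<in> configs d \<tau>" "b \<in> configs d P" for a b
  proof -
    have "\<tau> \<union> P \<subseteq> V"
      using \<tau> P(1) by blast
    then obtain x where x: "x \<in> configs d V" "restrict x (\<tau> \<union> P) = merge \<tau> P (a, b)"
      using configs_extend[OF merge_in_configs[OF ab]] d by blast
    have "restrict x \<tau> = a" "restrict x P = b"
      using arg_cong[OF x(2), of "\<lambda>z. restrict z \<tau>"] arg_cong[OF x(2), of "\<lambda>z. restrict z P"] P(2)
        restrict_configs_id[OF ab(1)] restrict_configs_id[OF ab(2)]
      by (simp_all add: Int_absorb1)
    with x(1) show ?thesis by blast
  qed
  have arr: "cond_array V E d \<tau> p (a, b) = \<P>(x in measure_pmf p. restrict x \<tau> = a \<bar> restrict x P = b)"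
    if "a \<in> configs d \<tau>" "b \<in> configs d P" for a b
    using that by (simp add: cond_array_def P_def)
  have arr_sum: "(\<Sum>a\<in>{a \<in> configs d \<tau>. restrict a \<sigma> = s}. cond_array V E d \<tau> p (a, b)) =
      \<P>(x in measure_pmf p. restrict x \<sigma> = s \<bar> restrict x P = b)"
    if "\<sigma> \<subseteq> \<tau>" "b \<in> configs d P" for \<sigma> s b
    using sum_cond_prob_configs[OF fin p that(1) \<tau>, where s = s and Q = "\<lambda>x. restrict x P = b"] arr[OF _ that(2)] by simp
  have pos: "cond_array V E d \<tau> p (a, b) > 0" if ab: "a \<in> configs d \<tau>" "b \<in> configs d P" for a b
  proof -
    obtain x where x: "x \<in> configs d V" "restrict x \<tau> = a" "restrict x P = b"
      using lift[OF ab] by blast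
    then show ?thesis
      using cond_prob_restrict[of p \<tau> x P] marginal_pos[OF p x(1)] arr[OF ab] by simp
  qed
  then show "a \<in> configs d \<tau> \<Longrightarrow> b \<in> configs d (pa_D V E \<tau>) \<Longrightarrow> cond_array V E d \<tau> p (a, b) > 0"
    by (simp add: P_def)
  obtain a0 where a0: "a0 \<in> configs d \<tau>"
    using configs_nonempty[of \<tau> d] d \<tau> by blast
  have "(\<Sum>a\<in>configs d \<tau>. cond_array V E d \<tau> p (a, b)) = 1" if b: "b \<in> configs d P" for b
  proof -
    obtain x where x: "x \<in> configs d V" "restrict x P = b"
      using lift[OF a0 b] by blast
    \<comment> \<open>The normalization is the case of the empty \<open>\<sigma>\<close>, whose
      restriction imposes no condition.\<close>
    have "{a \<in> configs d \<tau>. restrict a {} = restrict x {}} = configs d \<tau>"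
      by (auto simp: restrict_def)
    then have "(\<Sum>a\<in>configs d \<tau>. cond_array V E d \<tau> p (a, b)) =
        \<P>(y in measure_pmf p. restrict y {} = restrict x {} \<bar> restrict y P = restrict x P)"
      using arr_sum[of "{}" b "restrict x {}"] b x(2) by simp
    also have "\<dots> = 1"
      unfolding cond_prob_restrict using marginal_pos[OF p x(1), of P] by simp
    finally show ?thesis .
  qed
  moreover have "marginal_invariant d \<tau> P (cond_array V E d \<tau> p) \<sigma> (pa E \<sigma>)" if \<sigma>: "\<sigma> \<subseteq> \<tau>" for \<sigma>
    unfolding marginal_invariant_def
  proof (intro allI ballI impI)
    fix s b b' assume b: "b \<in> configs d P" and b': "b' \<in> configs d P"
      and bb': "restrict b (pa E \<sigma>) = restrict b' (pa E \<sigma>)"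
    have paP: "pa E \<sigma> \<subseteq> P"
      unfolding P_def by (rule pa_subset_pa_D[OF assms(1,2) \<sigma>])
    \<comment> \<open>Condition (C3b), rewritten as an equality of conditional
      probabilities.\<close>
    have ci: "marginal p (\<sigma> \<union> P) x / marginal p P x = marginal p (\<sigma> \<union> pa E \<sigma>) x / marginal p (pa E \<sigma>) x"
      if x: "x \<in> configs d V" for x
    proof -
      have "cond_indep p \<sigma> (P - pa E \<sigma>) (pa E \<sigma>)"
        using assms(2,3) \<sigma> by (simp add: P_IV_def P_def)
      moreover have "P - pa E \<sigma> \<union> pa E \<sigma> = P"
        using paP by blast
      ultimately have "marginal p (\<sigma> \<union> P) x * marginal p (pa E \<sigma>) x = marginal p (\<sigma> \<union> pa E \<sigma>) x * marginal p P x"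
        unfolding cond_indep_iff_marginal by (metis Un_assoc)
      then show ?thesis
        using marginal_pos[OF p x, of P] marginal_pos[OF p x, of "pa E \<sigma>"] by (simp add: field_simps)
    qed
    show "(\<Sum>a\<in>{a \<in> configs d \<tau>. restrict a \<sigma> = s}. cond_array V E d \<tau> p (a, b)) =
      (\<Sum>a\<in>{a \<in> configs d \<tau>. restrict a \<sigma> = s}. cond_array V E d \<tau> p (a, b'))"
    proof (cases "\<exists>a\<in>configs d \<tau>. restrict a \<sigma> = s")
      case True
      then obtain a where a: "a \<in> configs d \<tau>" "restrict a \<sigma> = s"
        by blast
      \<comment> \<open>The states \<open>x\<close> and \<open>x'\<close> share their
        \<open>\<tau>\<close>-part and agree on \<open>pa E \<sigma>\<close>, so the right-hand side
        of \<open>ci\<close> is the same for both.\<close>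
      obtain x where x: "x \<in> configs d V" "restrict x \<tau> = a" "restrict x P = b"
        using lift[OF a(1) b] by blast
      obtain x' where x': "x' \<in> configs d V" "restrict x' \<tau> = a" "restrict x' P = b'"
        using lift[OF a(1) b'] by blast
      have sub: "restrict (restrict y \<tau>) \<sigma> = restrict y \<sigma>" "restrict (restrict y P) (pa E \<sigma>) = restrict y (pa E \<sigma>)"
        for y :: "'a \<Rightarrow> nat"
        using \<sigma> paP by (simp_all add: Int_absorb1)
      have xx': "restrict x \<sigma> = s" "restrict x' \<sigma> = s" "restrict x (pa E \<sigma>) = restrict x' (pa E \<sigma>)"
        using sub[of x] sub[of x'] a(2) bb' unfolding x(2,3) x'(2,3) by simp_all
      have "\<P>(y in measure_pmf p. restrict y \<sigma> = s \<bar> restrict y P = b) =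
          marginal p (\<sigma> \<union> pa E \<sigma>) x / marginal p (pa E \<sigma>) x"
        using cond_prob_restrict[of p \<sigma> x P] ci[OF x(1)] x(3) xx'(1) by simp
      also have "\<dots> = marginal p (\<sigma> \<union> pa E \<sigma>) x' / marginal p (pa E \<sigma>) x'"
        using xx' by (metis marginal_cong restrict_Un_eq_iff)
      also have "\<dots> = \<P>(y in measure_pmf p. restrict y \<sigma> = s \<bar> restrict y P = b')"
        using cond_prob_restrict[of p \<sigma> x' P] ci[OF x'(1)] x'(3) xx'(2) by simp
      finally show ?thesis
        unfolding arr_sum[OF \<sigma> b] arr_sum[OF \<sigma> b'] .
    next
      case False
      then have empty: "{a \<in> configs d \<tau>. restrict a \<sigma> = s} = {}"
        by blast
      show ?thesis
        unfolding empty by simp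
    qed
  qed
  ultimately show "cond_array V E d \<tau> p \<in> linear_arrays V E d \<tau>"
    by (simp add: linear_arrays_def cond_array_def P_def)
qed

text \<open>The witness is \<open>joint\<close>. For \<open>\<tau>\<close> itself, (C1) and (C3b)
  come from \<open>cond_indep_component\<close>, and completeness settles (C2b); for every other
  component all three conditions come from \<open>cond_indep_rest\<close>.\<close>

lemma linear_array_is_cond_array:
  assumes G: "chain_graph V E" "\<tau> \<in> chain_components V E" "complete_set E \<tau>"
    and d: "\<And>v. v \<in> V \<Longrightarrow> d v \<ge> 1"
    and \<theta>: "\<theta> \<in> linear_arrays V E d \<tau>"
    and pos: "\<And>a b. a \<in> configs d \<tau> \<Longrightarrow> b \<in> configs d (pa_D V E \<tau>) \<Longrightarrow> \<theta> (a, b) > 0"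
  shows "\<theta> \<in> cond_arrays V E d \<tau>"
proof -
  define P where "P = pa_D V E \<tau>"
  have \<tau>: "\<tau> \<subseteq> V"
    by (rule chain_component_subset[OF G(2)])
  have P: "P \<subseteq> V" "\<tau> \<inter> P = {}"
    unfolding P_def by (rule pa_D_subset, rule pa_D_disjoint[OF G(1,2)])
  interpret component_array V \<tau> P d \<theta>
  proof
    show "finite V"
      using G(1) by (simp add: chain_graph_def graph_on_def)
    show "P \<subseteq> V - \<tau>"
      using P by blast
    show "\<And>b. b \<in> configs d P \<Longrightarrow> (\<Sum>a\<in>configs d \<tau>. \<theta> (a, b)) = 1"
      using \<theta> by (simp add: linear_arrays_def P_def)
  qed (use d pos \<tau> in \<open>auto simp: P_def\<close>)
  have "joint \<in> P_IV V E d"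
    unfolding P_IV_def
  proof (intro CollectI conjI ballI allI impI joint_in_open_simplex)
    fix \<rho> \<sigma> assume \<rho>: "\<rho> \<in> chain_components V E" and \<sigma>: "\<sigma> \<subseteq> \<rho>"
    have C: "cond_indep joint \<rho> (nd_D V E \<rho> - pa_D V E \<rho>) (pa_D V E \<rho>) \<and>
      cond_indep joint \<sigma> (\<rho> - Nb E \<sigma>) (pa_D V E \<rho>) \<and>
      cond_indep joint \<sigma> (pa_D V E \<rho> - pa E \<sigma>) (pa E \<sigma>)"
    proof (cases "\<rho> = \<tau>")
      case True
      have "marginal_invariant d \<tau> P \<theta> \<tau> P"
        by (auto simp: marginal_invariant_def restrict_configs_id)
      moreover have "nd_D V E \<tau> - P \<subseteq> V - \<tau>"
        using nd_D_subset[of V E \<tau>] nd_D_disjoint[OF G(2)] by blast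
      ultimately have "cond_indep joint \<tau> (nd_D V E \<tau> - P) P"
        by (intro cond_indep_component) auto
      moreover have "cond_indep joint \<sigma> (\<tau> - Nb E \<sigma>) P"
      \<comment> \<open>For empty \<open>\<sigma>\<close> the set
        \<open>\<tau> - Nb E \<sigma>\<close> is all of \<open>\<tau>\<close>, and the statement is
        void because of its other side.\<close>
      proof (cases "\<sigma> = {}")
        case False
        then have "\<tau> - Nb E \<sigma> = {}"
          using complete_component_Nb[OF G] \<sigma> True by simp
        then show ?thesis
          by (simp only: cond_indep_empty)
      qed (simp only: cond_indep_empty)
      moreover have "cond_indep joint \<sigma> (P - pa E \<sigma>) (pa E \<sigma>)"
      proof (intro cond_indep_component)
        show "pa E \<sigma> \<subseteq> P"
          using pa_subset_pa_D[OF G(1,2)] \<sigma> True by (simp add: P_def)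
        show "marginal_invariant d \<tau> P \<theta> \<sigma> (pa E \<sigma>)"
          using \<theta> \<sigma> True by (simp add: linear_arrays_def P_def)
      qed (use \<sigma> True P in auto)
      ultimately show ?thesis
        unfolding True P_def by blast
    next
      case False
      have \<rho>V: "\<rho> \<subseteq> V" "\<rho> \<inter> \<tau> = {}"
        by (rule chain_component_subset[OF \<rho>], rule chain_components_disjoint[OF \<rho> G(2) False])
      have sub: "nd_D V E \<rho> \<subseteq> V" "pa_D V E \<rho> \<subseteq> V" "\<rho> \<inter> nd_D V E \<rho> = {}" "\<rho> \<inter> pa_D V E \<rho> = {}"
        by (rule nd_D_subset pa_D_subset nd_D_disjoint[OF \<rho>] pa_D_disjoint[OF G(1) \<rho>])+
      have pa: "pa E \<sigma> \<subseteq> pa_D V E \<rho>"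
        by (rule pa_subset_pa_D[OF G(1) \<rho> \<sigma>])
      have "\<tau> \<inter> (nd_D V E \<rho> \<union> pa_D V E \<rho>) = {} \<or> \<rho> \<inter> P = {}"
        using child_disjoint_pa_D_nd_D[OF G(1,2) \<rho>] by (auto simp: P_def)
      \<comment> \<open>The alternative passes to subsets. Adding \<open>\<rho>\<close>, which is
        disjoint from \<open>\<tau>\<close>, to the bound on \<open>B\<close> accommodates the set
        \<open>\<rho> - Nb E \<sigma>\<close> of (C2b).\<close>
      then have free: "\<tau> \<inter> B = {} \<or> \<upsilon> \<inter> P = {}"
        if "\<upsilon> \<subseteq> \<rho>" "B \<subseteq> nd_D V E \<rho> \<union> pa_D V E \<rho> \<union> \<rho>" for B \<upsilon>
        using that \<rho>V(2) by blast
      have \<sigma>\<tau>: "\<sigma> \<subseteq> V - \<tau>"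
        using \<sigma> \<rho>V by blast
      have "cond_indep joint \<rho> (nd_D V E \<rho> - pa_D V E \<rho>) (pa_D V E \<rho>)"
        using \<rho>V sub by (intro cond_indep_rest free) auto
      moreover have "cond_indep joint \<sigma> (\<rho> - Nb E \<sigma>) (pa_D V E \<rho>)"
      proof (intro cond_indep_rest \<sigma>\<tau> free[OF \<sigma>])
        show "\<rho> - Nb E \<sigma> \<subseteq> V - \<sigma>" "pa_D V E \<rho> \<subseteq> V - \<sigma>"
          using \<rho>V \<sigma> sub(2,4) unfolding Nb_def by blast+
      qed auto
      moreover have "cond_indep joint \<sigma> (pa_D V E \<rho> - pa E \<sigma>) (pa E \<sigma>)"
      proof (intro cond_indep_rest \<sigma>\<tau> free[OF \<sigma>])
        show "pa_D V E \<rho> - pa E \<sigma> \<subseteq> V - \<sigma>" "pa E \<sigma> \<subseteq> V - \<sigma>"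
          using \<sigma> sub(2,4) pa by blast+
      qed (use pa in auto)
      ultimately show ?thesis by blast
    qed
    show "cond_indep joint \<rho> (nd_D V E \<rho> - pa_D V E \<rho>) (pa_D V E \<rho>)"
      "cond_indep joint \<sigma> (\<rho> - Nb E \<sigma>) (pa_D V E \<rho>)"
      "cond_indep joint \<sigma> (pa_D V E \<rho> - pa E \<sigma>) (pa E \<sigma>)"
      using C by simp_all
  qed
  moreover have "cond_array V E d \<tau> joint = \<theta>"
  proof (rule extensionalityI)
    show "cond_array V E d \<tau> joint \<in> extensional (configs d \<tau> \<times> configs d P)"
      by (simp add: cond_array_def P_def)
    show "\<theta> \<in> extensional (configs d \<tau> \<times> configs d P)"
      using \<theta> by (simp add: linear_arrays_def P_def)
    show "cond_array V E d \<tau> joint x = \<theta> x" if "x \<in> configs d \<tau> \<times> configs d P" for x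
      using that cond_prob_joint by (auto simp: cond_array_def P_def)
  qed
  ultimately show ?thesis
    unfolding cond_arrays_def by (metis imageI)
qed

text \<open>Both inclusions together give the arrays of the model the form required of
  \<open>S\<close> in \<open>weighted_log_sum_unique_local_max\<close>.\<close>

lemma cond_arrays_eq:
  assumes "chain_graph V E" "\<And>v. v \<in> V \<Longrightarrow> d v \<ge> 1" "\<tau> \<in> chain_components V E" "complete_set E \<tau>"
  shows "cond_arrays V E d \<tau> = {\<theta> \<in> linear_arrays V E d \<tau>.
    \<forall>x\<in>configs d \<tau> \<times> configs d (pa_D V E \<tau>). \<theta> x > 0}"
  using cond_array_linear[OF assms(1,3) _ assms(2)] linear_array_is_cond_array[OF assms(1,3,4,2)]
  unfolding cond_arrays_def by auto

text \<open>The uniform array satisfies all constraints, since its entries do not vary with the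
  state of the parents.\<close>

lemma cond_arrays_nonempty:
  assumes "chain_graph V E" "\<And>v. v \<in> V \<Longrightarrow> d v \<ge> 1" "\<tau> \<in> chain_components V E" "complete_set E \<tau>"
  shows "cond_arrays V E d \<tau> \<noteq> {}"
proof -
  have "finite \<tau>" "\<tau> \<subseteq> V"
    using assms(1) chain_component_subset[OF assms(3)] finite_subset
    by (auto simp: chain_graph_def graph_on_def)
  then have "card (configs d \<tau>) > 0"
    using configs_nonempty[of \<tau> d] assms(2) by (auto simp: card_gt_0_iff finite_configs)
  then have "(\<lambda>x\<in>configs d \<tau> \<times> configs d (pa_D V E \<tau>). 1 / card (configs d \<tau>)) \<in>
      {\<theta> \<in> linear_arrays V E d \<tau>. \<forall>x\<in>configs d \<tau> \<times> configs d (pa_D V E \<tau>). \<theta> x > 0}"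
    by (simp add: linear_arrays_def marginal_invariant_def)
  also have "\<dots> = cond_arrays V E d \<tau>"
    by (rule cond_arrays_eq[OF assms, symmetric])
  finally show ?thesis by blast
qed

theorem theorem13:
  fixes V :: "'v set" and E :: "('v \<times> 'v) set" and d :: "'v \<Rightarrow> nat" and \<tau> :: "'v set"
    and n :: nat and X :: "nat \<Rightarrow> 'v \<Rightarrow> nat"
  assumes "chain_graph V E"
    and "\<And>v. v \<in> V \<Longrightarrow> d v \<ge> 1"
    and "\<And>k. k \<in> {1..n} \<Longrightarrow> X k \<in> configs d V"
    and "\<tau> \<in> chain_components V E"
    and "complete_set E \<tau>"
    and "\<And>a b. a \<in> configs d \<tau> \<Longrightarrow> b \<in> configs d (pa_D V E \<tau>) \<Longrightarrow>
           component_count V E d n X \<tau> a b > 0"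
  shows "(\<exists>!\<theta>. local_max_on (component_loglik V E d n X \<tau>) (cond_arrays V E d \<tau>) \<theta>) \<and>
         (\<forall>\<theta>. local_max_on (component_loglik V E d n X \<tau>) (cond_arrays V E d \<tau>) \<theta> \<longrightarrow>
            is_arg_max (component_loglik V E d n X \<tau>) (\<lambda>\<theta>'. \<theta>' \<in> cond_arrays V E d \<tau>) \<theta>)"
proof -
  define D where "D = configs d \<tau> \<times> configs d (pa_D V E \<tau>)"
  define c where "c = (\<lambda>(a, b). real (component_count V E d n X \<tau> a b))"
  have fin: "finite V"
    using assms(1) by (simp add: chain_graph_def graph_on_def)
  have fin_configs: "finite (configs d \<tau>)" "finite (configs d (pa_D V E \<tau>))"
    using finite_subset[OF chain_component_subset[OF assms(4)] fin] finite_subset[OF pa_D_subset fin]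
    by (simp_all add: finite_configs)
  have loglik: "component_loglik V E d n X \<tau> = (\<lambda>\<theta>. \<Sum>x\<in>D. c x * ln (\<theta> x))"
    unfolding component_loglik_def D_def c_def by (simp add: sum.cartesian_product case_prod_unfold)
  have S: "cond_arrays V E d \<tau> = {\<theta> \<in> linear_arrays V E d \<tau>. \<forall>x\<in>D. \<theta> x > 0}"
    unfolding D_def by (rule cond_arrays_eq[OF assms(1,2,4,5)])
  show ?thesis
    unfolding loglik
  \<comment> \<open>The closed convex set \<open>C\<close> is
    \<open>linear_arrays V E d \<tau>\<close>. The bound by 1 follows from positivity and
    normalization for each parent state.\<close>
  proof (rule weighted_log_sum_unique_local_max)
    show "\<theta> x \<le> 1" if "\<theta> \<in> cond_arrays V E d \<tau>" "x \<in> D" for \<theta> x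
    proof -
      obtain a b where x: "x = (a, b)" "a \<in> configs d \<tau>" "b \<in> configs d (pa_D V E \<tau>)"
        using \<open>x \<in> D\<close> by (auto simp: D_def)
      have "\<theta> (a, b) \<le> (\<Sum>a'\<in>configs d \<tau>. \<theta> (a', b))"
        using that x by (intro member_le_sum fin_configs) (auto simp: S D_def less_imp_le)
      also have "\<dots> = 1"
        using that x by (simp add: S linear_arrays_def)
      finally show ?thesis
        by (simp add: x)
    qed
    show "c x > 0" if "x \<in> D" for x
      using that assms(6) by (auto simp: c_def D_def)
    show "finite D"
      using fin_configs by (simp add: D_def)
    show "cond_arrays V E d \<tau> \<noteq> {}"
      by (rule cond_arrays_nonempty[OF assms(1,2,4,5)])
    show "linear_arrays V E d \<tau> \<subseteq> extensional D"
      by (auto simp: linear_arrays_def D_def)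
  qed (use S in \<open>auto intro: closed_linear_arrays convex_combination_linear_arrays\<close>)
qed

end
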